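(* Let $\nu\in\mathbb{R}$ and let $J_\nu$ be the Bessel function of the first kind. Define real numbers $\alpha_{s,n}$ ($s,n\in\mathbb{N}_0$, with the convention $\alpha_{-1,n}=0$) recursively as follows. For $m\ge 0$, $$\alpha_{2m,0}=(-1)^mA_{2m}(\nu),\qquad \alpha_{2m+1,0}=(-1)^{m+1}A_{2m+1}(\nu),$$ where $$A_s(\nu)=\frac{(4\nu^2-1)(4\nu^2-3^2)\cdots(4\nu^2-(2s-1)^2)}{s!\,8^s}.$$ For $n\ge 0$ and $m\ge 0$, $$\alpha_{2m,2n+1}=-\frac{4m-1}{2}\alpha_{2m-1,2n}-\alpha_{2m,2n},\qquad \alpha_{2m+1,2n+1}=\alpha_{2m+1,2n}-\frac{4m+1}{2}\alpha_{2m,2n},$$ and for $n\ge 1$ and $m\ge 0$, $$\alpha_{2m,2n}=\alpha_{2m,2n-1}-\frac{4m-1}{2}\alpha_{2m-1,2n-1},\qquad \alpha_{2m+1,2n}=-\alpha_{2m+1,2n-1}-\frac{4m+1}{2}\alpha_{2m,2n-1}.$$ Then for every $n\in\mathbb{N}_0$, for large $x$ the even and odd derivatives of $J_\nu$ can be expressed as $$\sqrt{\tfrac12\pi x}\,J_\nu^{(2n)}(x)=\cos\left(x-\tfrac{\nu\pi}{2}-\tfrac{\pi}{4}\right)\tau_\nu^{(2n)}(x)+\sin\left(x-\tfrac{\nu\pi}{2}-\tfrac{\pi}{4}\right)\theta_\nu^{(2n)}(x),$$ $$\sqrt{\tfrac12\pi x}\,J_\nu^{(2n+1)}(x)=\cos\left(x-\tfrac{\nu\pi}{2}-\tfrac{\pi}{4}\right)\theta_\nu^{(2n+1)}(x)+\sin\left(x-\tfrac{\nu\pi}{2}-\tfrac{\pi}{4}\right)\tau_\nu^{(2n+1)}(x),$$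 where, for each $N\in\{2n,2n+1\}$, the functions $\tau_\nu^{(N)}$ and $\theta_\nu^{(N)}$ have the asymptotic expansions, as $x\to+\infty$, $$\tau_\nu^{(N)}(x)\sim\sum_{m=0}^{\infty}\frac{\alpha_{2m,N}}{x^{2m}},\qquad \theta_\nu^{(N)}(x)\sim\sum_{m=0}^{\infty}\frac{\alpha_{2m+1,N}}{x^{2m+1}}.$$
   Context: $\mathbb{N}_0=\{0,1,2,\ldots\}$. $J_\nu^{(N)}$ denotes the $N$-th derivative of $J_\nu$ with respect to its argument, and $J_\nu^{(0)}=J_\nu$. $A_0(\nu)=1$ (empty product). The symbol $\sim$ denotes a Poincaré asymptotic expansion as $x\to+\infty$ with $\nu$ fixed. *)

theory Defs
  imports "HOL-Analysis.Analysis" "HOL-Library.Landau_Symbols"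
begin

text \<open>
  Bessel function of the first kind of real order, for positive argument. Since \<open>rGamma\<close> is the
  (entire) reciprocal Gamma function, terms with \<open>\<nu> + k + 1\<close> a nonpositive integer vanish. For
  \<open>x \<le> 0\<close> the real-valued \<open>powr\<close> makes the value a junk value; only large \<open>x\<close> is ever used.
\<close>
definition bessel_J :: "real \<Rightarrow> real \<Rightarrow> real" where
  "bessel_J \<nu> x =
     (x / 2) powr \<nu> * (\<Sum>k. (-1) ^ k * rGamma (\<nu> + real k + 1) / fact k * (x\<^sup>2 / 4) ^ k)"

definition bessel_A :: "nat \<Rightarrow> real \<Rightarrow> real" where
  "bessel_A s \<nu> = (\<Prod>j=1..s. 4 * \<nu>\<^sup>2 - (2 * real j - 1)\<^sup>2) / (fact s * 8 ^ s)"

text \<open>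
  \<open>bessel_alpha \<nu> s n\<close> is $\alpha_{s,n}$. The recursion is on \<open>n\<close>; \<open>m = s div 2\<close>, so that
  \<open>s = 2 * m\<close> or \<open>s = 2 * m + 1\<close>, and \<open>p\<close> is $\alpha_{s-1,n}$ with $\alpha_{-1,n} = 0$.
  The lemmas below restate this as recurrences for each parity of \<open>s\<close> and \<open>n\<close>.
\<close>
fun bessel_alpha :: "real \<Rightarrow> nat \<Rightarrow> nat \<Rightarrow> real" where
  "bessel_alpha \<nu> s 0 =
     (if even s then (-1) ^ (s div 2) else (-1) ^ (s div 2 + 1)) * bessel_A s \<nu>"
| "bessel_alpha \<nu> s (Suc n) =
     (let m = real (s div 2);
          a = bessel_alpha \<nu> s n;
          p = (if s = 0 then 0 else bessel_alpha \<nu> (s - 1) n)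
      in if even n
         then (if even s then - (4 * m - 1) / 2 * p - a else a - (4 * m + 1) / 2 * p)
         else (if even s then a - (4 * m - 1) / 2 * p else - a - (4 * m + 1) / 2 * p))"

lemma bessel_alpha_even_0: "bessel_alpha \<nu> (2 * m) 0 = (-1) ^ m * bessel_A (2 * m) \<nu>"
  by simp

lemma bessel_alpha_odd_0:
  "bessel_alpha \<nu> (2 * m + 1) 0 = (-1) ^ (m + 1) * bessel_A (2 * m + 1) \<nu>"
  by simp

lemma bessel_alpha_even_odd:
  "bessel_alpha \<nu> (2 * m) (2 * n + 1) =
     - (4 * real m - 1) / 2 * (if m = 0 then 0 else bessel_alpha \<nu> (2 * m - 1) (2 * n))
     - bessel_alpha \<nu> (2 * m) (2 * n)"
  by (simp add: Let_def)

lemma bessel_alpha_odd_odd: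
  "bessel_alpha \<nu> (2 * m + 1) (2 * n + 1) =
     bessel_alpha \<nu> (2 * m + 1) (2 * n) - (4 * real m + 1) / 2 * bessel_alpha \<nu> (2 * m) (2 * n)"
  by (simp add: Let_def)

lemma bessel_alpha_even_even:
  assumes "n \<ge> 1"
  shows "bessel_alpha \<nu> (2 * m) (2 * n) =
     bessel_alpha \<nu> (2 * m) (2 * n - 1)
     - (4 * real m - 1) / 2 * (if m = 0 then 0 else bessel_alpha \<nu> (2 * m - 1) (2 * n - 1))"
proof -
  obtain k where k: "2 * n = Suc k" "odd k" "2 * n - 1 = k"
    using assms by (metis One_nat_def Suc_pred even_Suc dvd_triv_left mult_pos_pos
        less_eq_Suc_le zero_less_numeral One_nat_def diff_Suc_1)
  show ?thesis
    unfolding k(3) unfolding k(1) using k(2) by (simp add: Let_def)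
qed

lemma bessel_alpha_odd_even:
  assumes "n \<ge> 1"
  shows "bessel_alpha \<nu> (2 * m + 1) (2 * n) =
     - bessel_alpha \<nu> (2 * m + 1) (2 * n - 1)
     - (4 * real m + 1) / 2 * bessel_alpha \<nu> (2 * m) (2 * n - 1)"
proof -
  obtain k where k: "2 * n = Suc k" "odd k" "2 * n - 1 = k"
    using assms by (metis One_nat_def Suc_pred even_Suc dvd_triv_left mult_pos_pos
        less_eq_Suc_le zero_less_numeral One_nat_def diff_Suc_1)
  show ?thesis
    unfolding k(3) unfolding k(1) using k(2) by (simp add: Let_def)
qed

text \<open>
  Poincare asymptotic expansion $f \sim \sum_m a_m \varphi_m$ along the filter \<open>F\<close>, with respect
  to the asymptotic scale \<open>\<phi>\<close>. No convergence of the series is required.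
\<close>
definition has_asymptotic_expansion ::
  "(real \<Rightarrow> real) \<Rightarrow> (nat \<Rightarrow> real) \<Rightarrow> (nat \<Rightarrow> real \<Rightarrow> real) \<Rightarrow> real filter \<Rightarrow> bool" where
  "has_asymptotic_expansion f a \<phi> F \<longleftrightarrow>
     (\<forall>m. \<phi> (Suc m) \<in> o[F](\<phi> m)) \<and>
     (\<forall>M. (\<lambda>x. f x - (\<Sum>m\<le>M. a m * \<phi> m x)) \<in> o[F](\<phi> M))"

end

theory Submission
  imports Defs "HOL-Complex_Analysis.Complex_Analysis" "HOL-Real_Asymp.Real_Asymp"
begin

text \<open>
  Put \<open>\<omega> = x - \<nu> * pi / 2 - pi / 4\<close>. It is enough to find, for each order of differentiation \<open>N\<close>, a
  complex amplitude \<open>H\<close> with an expansion in powers of \<open>1 / x\<close> such that the \<open>N\<close>-th derivative of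
  \<open>J\<^sub>\<nu>\<close>, multiplied by \<open>sqrt (pi * x / 2)\<close>, is the real part of \<open>cis \<omega> * H x\<close> (predicate
  \<open>has_hankel_form\<close>). Up to sign, \<open>\<tau>\<close> and \<open>\<theta>\<close> are then the real and imaginary parts of \<open>H\<close>, in
  this order for even \<open>N\<close> and in the reverse order for odd \<open>N\<close>: the
  coefficients of \<open>H\<close> are the numbers \<open>\<alpha>\<close> multiplied by \<open>1\<close> or \<open>-\<i>\<close>, alternating in the index
  (\<open>hankel_coeff\<close>), so each of the two parts retains every other power of \<open>1 / x\<close>.

  Asymptotic expansions cannot in general be differentiated term by term. This is avoided by the
  exact relations \<open>2 J\<^sub>\<nu>' = J\<^sub>\<nu>\<^sub>-\<^sub>1 - J\<^sub>\<nu>\<^sub>+\<^sub>1\<close> and \<open>J\<^sub>\<nu>\<^sub>-\<^sub>1 + J\<^sub>\<nu>\<^sub>+\<^sub>1 = (2\<nu> / x) J\<^sub>\<nu>\<close>, both read off the power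
  series. The former writes a derivative as a difference of undifferentiated functions of
  neighbouring orders, so all derivatives follow from \<open>N = 0\<close> for all real orders; the latter
  carries \<open>N = 0\<close> from large orders down to arbitrary ones. A change of order by one turns the
  phase by \<open>pi / 2\<close>, that is, multiplies the amplitude by \<open>\<i>\<close> or \<open>-\<i>\<close>. What remains are two
  contiguous relations between the coefficients \<open>A\<^sub>s(\<nu>)\<close> and \<open>A\<^sub>s(\<nu> \<plusminus> 1)\<close>; the recursion that defines
  \<open>\<alpha>\<close> respects them because it does not involve \<open>\<nu>\<close> (\<open>hankel_coeff_contiguous\<close>).

  For \<open>\<nu> > 1 / 2\<close> and \<open>N = 0\<close>, write \<open>a = \<nu> - 1 / 2\<close>. Poisson's integral expresses \<open>J\<^sub>\<nu>\<close> through
  \<open>\<integral> (1 - t\<^sup>2)\<^sup>a cos (x t) dt\<close> over \<open>[0, 1]\<close>, the real part of the integral of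
  \<open>(1 - z\<^sup>2)\<^sup>a exp (\<i> x z)\<close>. Cauchy's theorem on the unit square with vertices
  \<open>0, 1, 1 + \<i>, \<i>\<close> moves it to the edge above \<open>1\<close>: the edge on the imaginary axis contributes
  nothing to the real part, and the top edge only an exponentially small error
  (\<open>Poisson_contour_shift\<close>). On the edge above \<open>1\<close> the integral is the Laplace integral of
  \<open>s\<^sup>a (1 + \<i> s / 2)\<^sup>a\<close> over \<open>[0, 1]\<close>, up to a constant factor and the phase \<open>cis \<omega>\<close>.
  \<open>Watson_lemma\<close> and the binomial expansion give its asymptotic series.
\<close>

section \<open>Recurrence and derivatives from the power series\<close>

definition bessel_coeff :: "real \<Rightarrow> nat \<Rightarrow> real" where
  "bessel_coeff \<nu> k = (-1) ^ k * rGamma (\<nu> + real k + 1) / fact k"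

text \<open>
  The series factor of \<open>J\<^sub>\<nu>\<close> as a function of \<open>y = x\<^sup>2 / 4\<close>. It is entire in \<open>y\<close>, so that it can be
  differentiated and rearranged term by term without regard to the power in front of it.
\<close>
definition bessel_entire :: "real \<Rightarrow> real \<Rightarrow> real" where
  "bessel_entire \<nu> y = (\<Sum>k. bessel_coeff \<nu> k * y ^ k)"

lemma bessel_J_eq: "bessel_J \<nu> x = (x / 2) powr \<nu> * bessel_entire \<nu> (x\<^sup>2 / 4)"
  by (simp add: bessel_J_def bessel_entire_def bessel_coeff_def)

lemma summable_bessel_coeff: "summable (\<lambda>k. bessel_coeff \<nu> k * y ^ k)"
proof (rule summable_ratio_test)
  \<comment> \<open>from this index on, the ratio \<open>\<bar>y\<bar> / ((k + 1) * (\<nu> + k + 1))\<close> of consecutive terms is at most \<open>1 / 2\<close>\<close>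
  define N where "N = nat \<lceil>2 * \<bar>y\<bar> + \<bar>\<nu>\<bar> + 1\<rceil>"
  fix k assume k: "N \<le> k"
  hence kN: "real k \<ge> 2 * \<bar>y\<bar> + \<bar>\<nu>\<bar> + 1"
    unfolding N_def by linarith
  define r where "r = rGamma (\<nu> + real k + 2)"
  have r: "rGamma (\<nu> + real k + 1) = (\<nu> + real k + 1) * r"
    using rGamma_plus1[of "\<nu> + real k + 1"] by (simp add: r_def add_ac)
  have "norm (bessel_coeff \<nu> (Suc k) * y ^ Suc k) = \<bar>r\<bar> * \<bar>y\<bar> ^ k / fact k * (\<bar>y\<bar> / real (Suc k))"
    by (simp add: bessel_coeff_def r_def abs_mult power_abs add_ac mult_ac)
  also have "\<bar>y\<bar> / real (Suc k) \<le> 1 / 2 * (\<nu> + real k + 1)"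
  proof -
    have "\<bar>y\<bar> / real (Suc k) \<le> 1 / 2"
      using kN by (simp add: divide_simps)
    also have "1 / 2 \<le> 1 / 2 * (\<nu> + real k + 1)"
      using kN by simp
    finally show ?thesis .
  qed
  hence "\<bar>r\<bar> * \<bar>y\<bar> ^ k / fact k * (\<bar>y\<bar> / real (Suc k)) \<le>
         \<bar>r\<bar> * \<bar>y\<bar> ^ k / fact k * (1 / 2 * (\<nu> + real k + 1))"
    by (intro mult_left_mono) auto
  also have "\<dots> = 1 / 2 * norm (bessel_coeff \<nu> k * y ^ k)"
    using kN by (simp add: bessel_coeff_def r abs_mult power_abs mult_ac)
  finally show "norm (bessel_coeff \<nu> (Suc k) * y ^ Suc k) \<le> 1 / 2 * norm (bessel_coeff \<nu> k * y ^ k)" .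
qed auto

lemma DERIV_bessel_entire:
  "(bessel_entire \<nu> has_real_derivative - bessel_entire (\<nu> + 1) y) (at y)"
proof -
  have "((\<lambda>y. \<Sum>k. bessel_coeff \<nu> k * y ^ k) has_real_derivative
          (\<Sum>k. diffs (bessel_coeff \<nu>) k * y ^ k)) (at y)"
    by (intro termdiffs_strong_converges_everywhere summable_bessel_coeff)
  also have "diffs (bessel_coeff \<nu>) = (\<lambda>k. - bessel_coeff (\<nu> + 1) k)"
    by (rule ext) (simp add: diffs_def bessel_coeff_def add_ac divide_simps)
  also have "(\<Sum>k. - bessel_coeff (\<nu> + 1) k * y ^ k) = - bessel_entire (\<nu> + 1) y"
    unfolding bessel_entire_def by (simp add: suminf_minus summable_bessel_coeff)
  finally show ?thesis
    by (simp add: bessel_entire_def [abs_def])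
qed

text \<open>
  Comparing coefficients of \<open>y ^ k\<close>: \<open>rGamma (\<nu> + k) = (\<nu> + k) * rGamma (\<nu> + k + 1)\<close>, in which the
  summand with \<open>\<nu>\<close> gives the first term and the summand with \<open>k\<close>, after cancelling against
  \<open>fact k\<close>, the second one with its index shifted by one.
\<close>
lemma bessel_entire_recurrence:
  "bessel_entire (\<nu> - 1) y = \<nu> * bessel_entire \<nu> y - y * bessel_entire (\<nu> + 1) y"
proof -
  have c0: "bessel_coeff (\<nu> - 1) 0 = \<nu> * bessel_coeff \<nu> 0"
    using rGamma_plus1[of \<nu>] by (simp add: bessel_coeff_def)
  have c: "bessel_coeff (\<nu> - 1) (Suc k) * y ^ Suc k =
           \<nu> * (bessel_coeff \<nu> (Suc k) * y ^ Suc k) - y * (bessel_coeff (\<nu> + 1) k * y ^ k)" for k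
  proof -
    have r: "rGamma (\<nu> + real k + 1) = (\<nu> + real k + 1) * rGamma (\<nu> + real k + 2)"
      using rGamma_plus1[of "\<nu> + real k + 1"] by (simp add: add_ac)
    have rg: "rGamma (1 + (\<nu> + real k)) = (\<nu> + real k + 1) * rGamma (\<nu> + (real k + 2))"
      using r by (simp add: add_ac)
    have "bessel_coeff (\<nu> - 1) (Suc k) = \<nu> * bessel_coeff \<nu> (Suc k) - bessel_coeff (\<nu> + 1) k"
      by (simp add: bessel_coeff_def add_ac r divide_simps del: of_nat_Suc)
         (simp add: algebra_simps rg)
    thus ?thesis by (simp only:) (simp add: algebra_simps)
  qed
  have "bessel_entire (\<nu> - 1) y =
          bessel_coeff (\<nu> - 1) 0 + (\<Sum>k. bessel_coeff (\<nu> - 1) (Suc k) * y ^ Suc k)"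
    unfolding bessel_entire_def using suminf_split_head[OF summable_bessel_coeff[of "\<nu> - 1" y]]
    by simp
  also have "(\<Sum>k. bessel_coeff (\<nu> - 1) (Suc k) * y ^ Suc k) =
      \<nu> * (\<Sum>k. bessel_coeff \<nu> (Suc k) * y ^ Suc k) - y * bessel_entire (\<nu> + 1) y"
  proof -
    have s: "summable (\<lambda>k. bessel_coeff \<nu> (Suc k) * y ^ Suc k)"
      using summable_bessel_coeff[of \<nu> y] by (subst summable_Suc_iff)
    show ?thesis
      unfolding bessel_entire_def c
      by (subst suminf_diff [symmetric] suminf_mult [symmetric] | intro s summable_mult summable_bessel_coeff)+
         simp
  qed
  also have "(\<Sum>k. bessel_coeff \<nu> (Suc k) * y ^ Suc k) = bessel_entire \<nu> y - bessel_coeff \<nu> 0"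
    unfolding bessel_entire_def using suminf_split_head[OF summable_bessel_coeff[of \<nu> y]]
    by simp
  finally show ?thesis by (simp add: c0 algebra_simps)
qed

lemma bessel_J_recurrence:
  assumes "x > 0"
  shows "bessel_J (\<nu> - 1) x = 2 * \<nu> / x * bessel_J \<nu> x - bessel_J (\<nu> + 1) x"
proof -
  have p: "(x / 2) powr \<nu> = (x / 2) powr (\<nu> - 1) * (x / 2)"
          "(x / 2) powr (\<nu> + 1) = (x / 2) powr (\<nu> - 1) * (x\<^sup>2 / 4)"
    using assms by (simp_all add: power2_eq_square powr_add powr_diff)
  show ?thesis
    unfolding bessel_J_eq bessel_entire_recurrence[of \<nu>] p using assms by (simp add: field_simps)
qed

lemma DERIV_bessel_J:
  assumes x: "x > 0"
  shows "(bessel_J \<nu> has_real_derivative (bessel_J (\<nu> - 1) x - bessel_J (\<nu> + 1) x) / 2) (at x)"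
proof -
  have "((\<lambda>x. (x / 2) powr \<nu> * bessel_entire \<nu> (x\<^sup>2 / 4)) has_real_derivative
          (\<nu> * (x / 2) powr (\<nu> - 1) * (1 / 2)) * bessel_entire \<nu> (x\<^sup>2 / 4) +
          - bessel_entire (\<nu> + 1) (x\<^sup>2 / 4) * (x / 2) * (x / 2) powr \<nu>) (at x)"
    by (intro DERIV_mult DERIV_chain2[OF DERIV_bessel_entire])
       (use x in \<open>auto intro!: derivative_eq_intros simp: powr_diff\<close>)
  also have "(\<lambda>x. (x / 2) powr \<nu> * bessel_entire \<nu> (x\<^sup>2 / 4)) = bessel_J \<nu>"
    by (rule ext) (simp add: bessel_J_eq)
  also have "(\<nu> * (x / 2) powr (\<nu> - 1) * (1 / 2)) * bessel_entire \<nu> (x\<^sup>2 / 4) +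
          - bessel_entire (\<nu> + 1) (x\<^sup>2 / 4) * (x / 2) * (x / 2) powr \<nu> =
          \<nu> / x * bessel_J \<nu> x - bessel_J (\<nu> + 1) x"
    using x by (simp add: bessel_J_eq powr_add powr_diff field_simps)
  also have "\<dots> = (bessel_J (\<nu> - 1) x - bessel_J (\<nu> + 1) x) / 2"
    unfolding bessel_J_recurrence[OF x, of \<nu>] by (simp add: field_simps)
  finally show ?thesis .
qed

text \<open>
  The induction produces the differentiability of the iterated derivative together with its value.
  Since \<open>deriv\<close> is total, the value alone would not allow the next derivative to be distributed over
  the difference.
\<close>
lemma DERIV_higher_deriv_bessel_J:
  assumes "x > 0"
  shows "((deriv ^^ N) (bessel_J \<nu>) has_real_derivative
           ((deriv ^^ N) (bessel_J (\<nu> - 1)) x - (deriv ^^ N) (bessel_J (\<nu> + 1)) x) / 2) (at x)"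
  using assms
proof (induction N arbitrary: \<nu> x)
  case 0
  thus ?case using DERIV_bessel_J by simp
next
  case (Suc N)
  have D: "(deriv ^^ Suc N) (bessel_J \<mu>) t =
        ((deriv ^^ N) (bessel_J (\<mu> - 1)) t - (deriv ^^ N) (bessel_J (\<mu> + 1)) t) / 2"
    if "t > 0" for \<mu> t
    using DERIV_imp_deriv[OF Suc.IH[OF that]] by simp
  have "((\<lambda>t. ((deriv ^^ N) (bessel_J (\<nu> - 1)) t - (deriv ^^ N) (bessel_J (\<nu> + 1)) t) / 2)
          has_real_derivative
          ((deriv ^^ Suc N) (bessel_J (\<nu> - 1)) x - (deriv ^^ Suc N) (bessel_J (\<nu> + 1)) x) / 2) (at x)"
    unfolding D[OF Suc.prems]
    by (intro DERIV_cdivide DERIV_diff Suc.IH Suc.prems)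
  thus ?case
    by (rule DERIV_cong_ev[THEN iffD1, rotated -1])
       (use Suc.prems D in \<open>auto intro!: eventually_mono[OF eventually_nhds_in_open[of "{0<..}"]]\<close>)
qed

lemma higher_deriv_bessel_J_Suc:
  assumes "x > 0"
  shows "(deriv ^^ Suc N) (bessel_J \<nu>) x =
           ((deriv ^^ N) (bessel_J (\<nu> - 1)) x - (deriv ^^ N) (bessel_J (\<nu> + 1)) x) / 2"
  using DERIV_imp_deriv[OF DERIV_higher_deriv_bessel_J[OF assms]] by simp

section \<open>Poisson's integral\<close>

lemma Gamma_nat_plus_half: "Gamma (real k + 1 / 2) = sqrt pi * fact (2 * k) / (4 ^ k * fact k)"
proof (induction k)
  case 0
  thus ?case by (simp add: Gamma_one_half_real)
next
  case (Suc k)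
  have "Gamma (real (Suc k) + 1 / 2) = (real k + 1 / 2) * Gamma (real k + 1 / 2)"
    using Gamma_plus1[of "real k + 1 / 2"] by (simp add: add_ac nonpos_Ints_def)
  also have "\<dots> = sqrt pi * fact (2 * Suc k) / (4 ^ Suc k * fact (Suc k))"
    unfolding Suc.IH by (simp add: divide_simps) (simp add: algebra_simps)
  finally show ?case .
qed

text \<open>
  The substitution \<open>t = sqrt u\<close> turns the moment into a Beta integral. It is carried out from \<open>t\<close> to
  \<open>u\<close> because the integrand is continuous on \<open>[0, 1]\<close> only in the variable \<open>t\<close>; the singularity of
  \<open>sqrt\<close> at \<open>0\<close> is the single exceptional point.
\<close>
lemma has_integral_semicircle_moment:
  fixes a :: real
  assumes "a > 0"
  shows "((\<lambda>t. (1 - t\<^sup>2) powr a * t ^ (2 * k)) has_integral Beta (real k + 1 / 2) (a + 1) / 2) {0..1}"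
proof -
  let ?f = "\<lambda>t::real. (1 - t\<^sup>2) powr a * t ^ (2 * k)"
  have cont: "continuous_on {0..1} ?f"
    using assms by (intro continuous_intros continuous_on_powr') (auto simp: power_le_one)
  have "((\<lambda>u. (1 / (2 * sqrt u)) *\<^sub>R ?f (sqrt u)) has_integral (integral {0..1} ?f)) {0..1}"
  proof (rule has_integral_substitution_strong[where s = "{0}" and g = sqrt and a = 0 and b = 1,
            unfolded real_sqrt_zero real_sqrt_one])
    show "continuous_on {0..1} ?f" by (rule cont)
    show "(sqrt has_real_derivative 1 / (2 * sqrt x)) (at x within {0..1})" if "x \<in> {0..1} - {0}" for x
      using that by (auto intro!: derivative_eq_intros simp: field_simps)
  qed (auto intro!: continuous_intros)
  hence "((\<lambda>u. u powr (real k + 1 / 2 - 1) * (1 - u) powr (a + 1 - 1) / 2) has_integral (integral {0..1} ?f)) {0..1}"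
  proof (rule has_integral_spike[of "{0}", rotated 2])
    fix u :: real assume u: "u \<in> {0..1} - {0}"
    have e: "sqrt u ^ (2 * k) = u ^ k"
      using u by (simp add: power_mult)
    have "u powr (real k + 1 / 2 - 1) = u powr (real k) * u powr (-1/2)"
      by (simp add: powr_add [symmetric])
    also have "\<dots> = u ^ k / sqrt u"
      using u by (simp add: powr_realpow powr_minus powr_half_sqrt divide_simps)
    finally show "u powr (real k + 1 / 2 - 1) * (1 - u) powr (a + 1 - 1) / 2 = (1 / (2 * sqrt u)) *\<^sub>R ?f (sqrt u)"
      using u e by (simp add: mult_ac)
  qed auto
  moreover have "((\<lambda>u. u powr (real k + 1 / 2 - 1) * (1 - u) powr (a + 1 - 1) / 2) has_integral (Beta (real k + 1 / 2) (a + 1) / 2)) {0..1}"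
    using assms by (intro has_integral_divide has_integral_Beta_real) auto
  ultimately have "integral {0..1} ?f = Beta (real k + 1 / 2) (a + 1) / 2"
    by (rule has_integral_unique)
  moreover have "?f integrable_on {0..1}"
    by (intro integrable_continuous_real cont)
  ultimately show ?thesis by (simp add: has_integral_iff)
qed

text \<open>
  Expanding the cosine and integrating term by term. The moments of \<open>(1 - t\<^sup>2) powr a\<close> are Beta values,
  whose factor \<open>Gamma (k + 1 / 2)\<close> converts \<open>fact (2 * k)\<close> into \<open>4 ^ k * fact k\<close>, which leaves
  the coefficients of the Bessel series of order \<open>a + 1 / 2\<close>.
\<close>
lemma has_integral_Poisson:
  fixes a x :: real
  assumes a: "a > 0"
  shows "((\<lambda>t. (1 - t\<^sup>2) powr a * cos (x * t)) has_integral
           sqrt pi * Gamma (a + 1) / 2 * bessel_entire (a + 1 / 2) (x\<^sup>2 / 4)) {0..1}"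
proof -
  let ?w = "\<lambda>t::real. (1 - t\<^sup>2) powr a"
  let ?c = "\<lambda>k. (-1) ^ k / fact (2 * k) * x ^ (2 * k) :: real"
  let ?g = "\<lambda>k t. ?c k * (?w t * t ^ (2 * k))"
  let ?F = "\<lambda>n t. \<Sum>k<n. ?g k t"
  have w: "0 \<le> ?w t" "?w t \<le> 1" if "t \<in> {0..1}" for t
    using that a by (auto intro!: powr_le1 simp: power_le_one)
  have "uniform_limit (cbox 0 1) ?F (\<lambda>t. \<Sum>k. ?g k t) sequentially"
  proof (rule Weierstrass_m_test)
    show "summable (\<lambda>k. (x\<^sup>2) ^ k / fact k)"
      using summable_exp[of "x\<^sup>2"] by (simp add: field_simps)
    fix k :: nat and t :: real assume t: "t \<in> cbox 0 1"
    have "norm (?g k t) = (x\<^sup>2) ^ k / fact (2 * k) * (?w t * t ^ (2 * k))"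
      using t by (simp add: abs_mult power_mult)
    also have "\<dots> \<le> (x\<^sup>2) ^ k / fact k * (1 * 1)"
      using w[of t] t by (intro mult_mono divide_left_mono fact_mono) (auto simp: power_le_one)
    finally show "norm (?g k t) \<le> (x\<^sup>2) ^ k / fact k" by simp
  qed
  also have "(\<lambda>t. \<Sum>k. ?g k t) = (\<lambda>t. ?w t * cos (x * t))"
  proof
    fix t
    have "(\<lambda>k. ?w t * ((-1) ^ k / fact (2 * k) * (x * t) ^ (2 * k))) sums (?w t * cos (x * t))"
      by (intro sums_mult cos_paired)
    thus "(\<Sum>k. ?g k t) = ?w t * cos (x * t)"
      by (simp add: sums_iff power_mult_distrib mult_ac)
  qed
  finally obtain I J where IJ: "\<And>n. (?F n has_integral I n) (cbox 0 1)"
    "((\<lambda>t. ?w t * cos (x * t)) has_integral J) (cbox 0 1)" "I \<longlonglongrightarrow> J"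
    by (rule uniform_limit_integral_cbox)
       (use a in \<open>auto intro!: continuous_intros continuous_on_powr' simp: power_le_one\<close>)
  have "I n = (\<Sum>k<n. ?c k * (Beta (real k + 1 / 2) (a + 1) / 2))" for n
  proof (rule has_integral_unique[OF IJ(1)])
    show "(?F n has_integral (\<Sum>k<n. ?c k * (Beta (real k + 1 / 2) (a + 1) / 2))) (cbox 0 1)"
      unfolding interval_cbox [symmetric]
      by (intro has_integral_sum has_integral_mult_right has_integral_semicircle_moment a) auto
  qed
  moreover have "?c k * (Beta (real k + 1 / 2) (a + 1) / 2) =
      sqrt pi * Gamma (a + 1) / 2 * (bessel_coeff (a + 1 / 2) k * (x\<^sup>2 / 4) ^ k)" for k
  proof -
    have "Beta (real k + 1 / 2) (a + 1) =
        sqrt pi * fact (2 * k) / (4 ^ k * fact k) * Gamma (a + 1) * rGamma (a + 1 / 2 + real k + 1)"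
      unfolding Beta_altdef Gamma_nat_plus_half by (simp add: add_ac)
    moreover have "x ^ (2 * k) = (x\<^sup>2) ^ k"
      by (rule power_mult)
    ultimately show ?thesis by (simp add: bessel_coeff_def power_divide mult_ac)
  qed
  ultimately have I: "I n = (\<Sum>k<n. sqrt pi * Gamma (a + 1) / 2 * (bessel_coeff (a + 1 / 2) k * (x\<^sup>2 / 4) ^ k))" for n
    by (simp only:)
  have "(\<lambda>k. sqrt pi * Gamma (a + 1) / 2 * (bessel_coeff (a + 1 / 2) k * (x\<^sup>2 / 4) ^ k)) sums J"
    unfolding sums_def I [symmetric] by (rule IJ(3))
  moreover have "(\<lambda>k. sqrt pi * Gamma (a + 1) / 2 * (bessel_coeff (a + 1 / 2) k * (x\<^sup>2 / 4) ^ k)) sums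
      (sqrt pi * Gamma (a + 1) / 2 * bessel_entire (a + 1 / 2) (x\<^sup>2 / 4))"
    unfolding bessel_entire_def by (intro sums_mult summable_sums summable_bessel_coeff)
  ultimately have "J = sqrt pi * Gamma (a + 1) / 2 * bessel_entire (a + 1 / 2) (x\<^sup>2 / 4)"
    by (rule sums_unique2)
  with IJ(2) show ?thesis by simp
qed

section \<open>Shifting the contour\<close>

text \<open>
  On the ray \<open>z = 1 + \<i> s\<close> one has \<open>1 - z\<^sup>2 = 2 s * (-\<i>) * (1 + \<i> s / 2)\<close>. The principal power is
  multiplicative here, since the arguments \<open>-pi / 2\<close> and \<open>arctan (s / 2)\<close> of the last two factors
  add up to a value strictly between \<open>-pi\<close> and \<open>pi\<close>.
\<close>
lemma powr_contour_edge:
  fixes a s :: real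
  assumes "s \<ge> 0"
  shows "(1 - (1 + \<i> * of_real s)\<^sup>2) powr of_real a =
           of_real ((2 * s) powr a) * cis (- (a * pi / 2)) * (1 + \<i> * of_real s / 2) powr of_real a"
proof -
  define w :: complex where "w = 1 + \<i> * of_real s / 2"
  have w: "Re w = 1" "Im w = s / 2" by (simp_all add: w_def)
  hence w0: "w \<noteq> 0" by auto
  have "1 - (1 + \<i> * of_real s)\<^sup>2 = of_real (2 * s) * (- \<i> * w)"
    by (simp add: w_def power2_eq_square algebra_simps)
  also have "\<dots> powr of_real a = of_real (2 * s) powr of_real a * (- \<i> * w) powr of_real a"
    using assms by (intro powr_times_real_left) auto
  also have "of_real (2 * s) powr of_real a = complex_of_real ((2 * s) powr a)"
    using assms by (subst powr_of_real) auto
  also have "Ln w = Ln (- \<i> * w) + \<i> * of_real pi / 2"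
    using Ln_times_ii[of "- \<i> * w"] w w0 assms by simp
  hence "(- \<i> * w) powr of_real a = cis (- (a * pi / 2)) * w powr of_real a"
    using w0 by (simp add: powr_def cis_conv_exp flip: exp_add) (simp add: algebra_simps)
  finally show ?thesis by (simp add: w_def mult_ac)
qed

text \<open>
  Cauchy's theorem on the unit square with vertices \<open>0, 1, 1 + \<i>, \<i>\<close>. The integrand vanishes at its
  branch point \<open>1\<close> because \<open>a > 0\<close>, so it is continuous on the closed square, which suffices. The
  remainder \<open>r\<close> is the contribution of the top edge, where \<open>exp (\<i> x z)\<close> has modulus \<open>exp (-x)\<close>.
  A square of fixed size is enough, as exponentially small terms do not affect an expansion in powers
  of \<open>1 / x\<close>.
\<close>
lemma Poisson_contour_shift:
  fixes a x :: real
  assumes a: "a > 0"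
  obtains r where
    "\<bar>r\<bar> \<le> 3 powr a * exp (-x)"
    "integral {0..1} (\<lambda>t. (1 - t\<^sup>2) powr a * cos (x * t)) = r +
      Re (- \<i> * cis (x - a * pi / 2) * integral {0..1} (\<lambda>s.
            of_real ((2 * s) powr a * exp (- x * s)) * (1 + \<i> * of_real s / 2) powr of_real a))"
proof -
  define f :: "complex \<Rightarrow> complex" where "f = (\<lambda>z. (1 - z\<^sup>2) powr of_real a * exp (\<i> * of_real x * z))"
  define S where "S = cbox 0 (Complex 1 1)"
  have re: "Re (1 - z\<^sup>2) = 1 - (Re z)\<^sup>2 + (Im z)\<^sup>2" for z
    by (simp add: power2_eq_square)
  have cont: "continuous_on S f"
    unfolding f_def S_def using a
    by (intro continuous_intros continuous_on_powr_complex)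
       (auto simp: in_cbox_complex_iff re power_le_one add_nonneg_nonneg simp del: minus_complex.sel)
  have diff: "f field_differentiable at z" if "z \<in> interior S" for z
  proof -
    have z: "0 < Re z" "Re z < 1"
      using that by (auto simp: S_def in_box_complex_iff)
    have "Re (1 - z\<^sup>2) > 0"
      unfolding re using z by (intro add_pos_nonneg) (auto simp: power_less_one_iff)
    hence "1 - z\<^sup>2 \<notin> \<real>\<^sub>\<le>\<^sub>0"
      by (metis complex_nonpos_Reals_iff not_less)
    hence "f analytic_on {z}"
      unfolding f_def by (intro analytic_intros) auto
    thus ?thesis by (rule analytic_on_imp_differentiable_at) auto
  qed
  have seg: "closed_segment p q \<subseteq> S" if "p \<in> S" "q \<in> S" for p q
    using that by (intro closed_segment_subset) (auto simp: S_def)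
  have corners: "0 \<in> S" "1 \<in> S" "1 + \<i> \<in> S" "\<i> \<in> S"
    by (auto simp: S_def in_cbox_complex_iff)
  define I where "I = (\<lambda>p q. contour_integral (linepath p q) f)"
  have int: "f contour_integrable_on linepath p q" if "p \<in> S" "q \<in> S" for p q
    using seg[OF that] cont by (intro contour_integrable_continuous_linepath) (rule continuous_on_subset)
  have Re_I: "((\<lambda>s. Re (f (linepath p q s) * (q - p))) has_integral Re (I p q)) {0..1}"
    if "p \<in> S" "q \<in> S" for p q
    using has_contour_integral_integral[OF int[OF that]]
    unfolding has_contour_integral_linepath I_def
    by (rule has_integral_Re)
  have "(f has_contour_integral 0)
          (linepath 0 1 +++ linepath 1 (1 + \<i>) +++ linepath (1 + \<i>) \<i> +++ linepath \<i> 0)"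
    by (rule Cauchy_theorem_convex[OF cont, of "{}"])
       (use diff seg corners in \<open>auto simp: S_def path_image_join\<close>)
  hence "contour_integral (linepath 0 1 +++ linepath 1 (1 + \<i>) +++ linepath (1 + \<i>) \<i> +++ linepath \<i> 0) f = 0"
    by (rule contour_integral_unique)
  hence sum0: "I 0 1 + I 1 (1 + \<i>) + I (1 + \<i>) \<i> + I \<i> 0 = 0"
    unfolding I_def using corners by (simp add: int contour_integrable_joinI add_ac)
  \<comment> \<open>on the imaginary axis the integrand is real while \<open>dz\<close> is imaginary\<close>
  have left: "Re (I \<i> 0) = 0"
  proof -
    have "Re (f (linepath \<i> 0 s) * (0 - \<i>)) = 0" for s
    proof -
      have 1: "1 - (linepath \<i> 0 s)\<^sup>2 = complex_of_real (1 + (1 - s)\<^sup>2)"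
        by (simp add: linepath_def power2_eq_square scaleR_conv_of_real algebra_simps)
      have 2: "\<i> * of_real x * linepath \<i> 0 s = complex_of_real (- x * (1 - s))"
        by (simp add: linepath_def scaleR_conv_of_real algebra_simps)
      have "f (linepath \<i> 0 s) = of_real ((1 + (1 - s)\<^sup>2) powr a) * of_real (exp (- x * (1 - s)))"
        unfolding f_def 1 2 by (simp only: exp_of_real powr_of_real add_nonneg_nonneg zero_le_power2 zero_le_one)
      thus ?thesis by simp
    qed
    with Re_I[OF corners(4,1)] show ?thesis
      by (simp add: has_integral_unique[OF _ has_integral_0])
  qed
  have bottom: "Re (I 0 1) = integral {0..1} (\<lambda>t. (1 - t\<^sup>2) powr a * cos (x * t))"
  proof -
    have "Re (f (linepath 0 1 t) * (1 - 0)) = (1 - t\<^sup>2) powr a * cos (x * t)" if t: "t \<in> {0..1}" for t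
    proof -
      have "(1 - (complex_of_real t)\<^sup>2) powr of_real a = complex_of_real ((1 - t\<^sup>2) powr a)"
        using t powr_of_real[of "1 - t\<^sup>2" a] by (simp add: power_le_one)
      thus ?thesis by (simp add: f_def linepath_def scaleR_conv_of_real Re_exp)
    qed
    from has_integral_eq[OF this Re_I[OF corners(1,2)]] show ?thesis
      by (simp add: integral_unique)
  qed
  have right: "I 1 (1 + \<i>) = \<i> * cis (x - a * pi / 2) * integral {0..1} (\<lambda>s.
            of_real ((2 * s) powr a * exp (- x * s)) * (1 + \<i> * of_real s / 2) powr of_real a)"
  proof -
    have e: "f (linepath 1 (1 + \<i>) s) * (1 + \<i> - 1) = \<i> * cis (x - a * pi / 2) *
            (of_real ((2 * s) powr a * exp (- x * s)) * (1 + \<i> * of_real s / 2) powr of_real a)"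
      if "s \<in> {0..1}" for s
    proof -
      have l: "linepath 1 (1 + \<i>) s = 1 + \<i> * of_real s"
        by (simp add: linepath_def scaleR_conv_of_real algebra_simps)
      have "exp (\<i> * of_real x * (1 + \<i> * of_real s)) = cis x * of_real (exp (- x * s))"
        by (simp add: cis_conv_exp algebra_simps flip: exp_add exp_of_real)
      moreover have "cis (x - a * pi / 2) = cis x * cis (- (a * pi / 2))"
        by (simp add: cis_mult)
      ultimately show ?thesis
        using powr_contour_edge[of s a] that by (simp add: f_def l mult_ac)
    qed
    have "I 1 (1 + \<i>) = integral {0..1} (\<lambda>s. f (linepath 1 (1 + \<i>) s) * (1 + \<i> - 1))"
      unfolding I_def using has_contour_integral_integral[OF int[OF corners(2,3)]]
      by (simp only: has_contour_integral_linepath integral_unique)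
    also have "\<dots> = integral {0..1} (\<lambda>s. \<i> * cis (x - a * pi / 2) *
            (of_real ((2 * s) powr a * exp (- x * s)) * (1 + \<i> * of_real s / 2) powr of_real a))"
      by (intro integral_cong e)
    finally show ?thesis by simp
  qed
  have top: "norm (I (1 + \<i>) \<i>) \<le> 3 powr a * exp (- x) * norm (\<i> - (1 + \<i>))"
    unfolding I_def
  proof (rule contour_integral_bound_linepath)
    show "f contour_integrable_on linepath (1 + \<i>) \<i>" by (intro int corners)
    fix z assume "z \<in> closed_segment (1 + \<i>) \<i>"
    then obtain u where u: "u \<in> {0..1}" "z = of_real u + \<i>"
      by (auto simp: closed_segment_def scaleR_conv_of_real algebra_simps intro: that[of "1 - _"])
    \<comment> \<open>\<open>\<bar>1 - z\<^sup>2\<bar> \<le> 1 + \<bar>z\<bar>\<^sup>2 \<le> 3\<close> on the top edge explains the constant \<open>3\<close>\<close>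
    have "norm z ^ 2 = u\<^sup>2 + 1" unfolding u(2) cmod_power2 by simp
    also have "\<dots> \<le> 2" using u by (simp add: power_le_one)
    finally have "norm (1 - z\<^sup>2) \<le> 3"
      using norm_triangle_ineq4[of 1 "z\<^sup>2"] by (simp add: norm_power)
    hence "norm ((1 - z\<^sup>2) powr of_real a) \<le> 3 powr a"
      using a by (subst norm_powr_real_powr') (auto intro!: powr_mono2)
    moreover have "norm (exp (\<i> * of_real x * z)) = exp (- x)"
      by (simp add: u)
    ultimately show "norm (f z) \<le> 3 powr a * exp (- x)"
      unfolding f_def norm_mult by (simp only: mult_right_mono exp_ge_zero)
  qed auto
  show ?thesis
  proof (rule that[of "- Re (I (1 + \<i>) \<i>)"])
    show "\<bar>- Re (I (1 + \<i>) \<i>)\<bar> \<le> 3 powr a * exp (- x)"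
      using top abs_Re_le_cmod[of "I (1 + \<i>) \<i>"] by simp
    have "Re (I 0 1) + Re (I 1 (1 + \<i>)) + Re (I (1 + \<i>) \<i>) = 0"
      using arg_cong[OF sum0, of Re] left by simp
    thus "integral {0..1} (\<lambda>t. (1 - t\<^sup>2) powr a * cos (x * t)) = - Re (I (1 + \<i>) \<i>) +
      Re (- \<i> * cis (x - a * pi / 2) * integral {0..1} (\<lambda>s.
            of_real ((2 * s) powr a * exp (- x * s)) * (1 + \<i> * of_real s / 2) powr of_real a))"
      unfolding bottom right by (simp only: mult_minus_left minus_complex.sel uminus_complex.sel)
  qed
qed

section \<open>Expansions in inverse powers\<close>

text \<open>
  The Poincare expansion of a complex amplitude, in a form convenient for calculation: with \<open>M\<close> terms
  subtracted, the error is at most of the size of the first omitted power. Including vanishing coefficients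
  makes one definition serve the even and the odd series at once.
\<close>
definition inverse_power_expansion :: "(real \<Rightarrow> complex) \<Rightarrow> (nat \<Rightarrow> complex) \<Rightarrow> bool" where
  "inverse_power_expansion H c \<longleftrightarrow>
     (\<forall>M. (\<lambda>x. H x - (\<Sum>k<M. c k / of_real x ^ k)) \<in> O[at_top](\<lambda>x. 1 / of_real x ^ M))"

lemma inverse_power_expansion_add:
  assumes "inverse_power_expansion H c" "inverse_power_expansion G d"
  shows "inverse_power_expansion (\<lambda>x. H x + G x) (\<lambda>k. c k + d k)"
  unfolding inverse_power_expansion_def
proof
  fix M
  have "(\<lambda>x. (H x - (\<Sum>k<M. c k / of_real x ^ k)) + (G x - (\<Sum>k<M. d k / of_real x ^ k)))
          \<in> O[at_top](\<lambda>x. 1 / of_real x ^ M)"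
    using assms by (intro sum_in_bigo(1)) (auto simp only: inverse_power_expansion_def)
  thus "(\<lambda>x. H x + G x - (\<Sum>k<M. (c k + d k) / of_real x ^ k)) \<in> O[at_top](\<lambda>x. 1 / of_real x ^ M)"
    by (simp add: sum.distrib add_divide_distrib algebra_simps)
qed

lemma inverse_power_expansion_cmult:
  assumes "inverse_power_expansion H c"
  shows "inverse_power_expansion (\<lambda>x. u * H x) (\<lambda>k. u * c k)"
  unfolding inverse_power_expansion_def
proof
  fix M
  have "(\<lambda>x. u * (H x - (\<Sum>k<M. c k / of_real x ^ k))) \<in> O[at_top](\<lambda>x. 1 / of_real x ^ M)"
    using assms by (cases "u = 0") (auto simp: inverse_power_expansion_def)
  thus "(\<lambda>x. u * H x - (\<Sum>k<M. u * c k / of_real x ^ k)) \<in> O[at_top](\<lambda>x. 1 / of_real x ^ M)"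
    by (simp add: right_diff_distrib sum_distrib_left)
qed

lemma inverse_power_expansion_divide_x:
  assumes "inverse_power_expansion H c"
  shows "inverse_power_expansion (\<lambda>x. H x / of_real x) (case_nat 0 c)"
  unfolding inverse_power_expansion_def
proof
  fix M
  have *: "(\<lambda>x. (H x - (\<Sum>k<j. c k / of_real x ^ k)) * (1 / of_real x))
          \<in> O[at_top](\<lambda>x. 1 / of_real x ^ j * (1 / of_real x))" for j
    using assms by (intro landau_o.big.mult) (auto simp: inverse_power_expansion_def)
  show "(\<lambda>x. H x / of_real x - (\<Sum>k<M. case_nat 0 c k / of_real x ^ k)) \<in> O[at_top](\<lambda>x. 1 / of_real x ^ M)"
  proof (cases M)
    case 0
    have "(\<lambda>x. 1 / complex_of_real x) \<in> O[at_top](\<lambda>x. 1)"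
      by (rule bigoI[of _ 1]) (auto simp: norm_divide intro!: eventually_mono[OF eventually_ge_at_top[of 1]])
    with *[of 0] show ?thesis
      using 0 landau_o.big.trans by fastforce
  next
    case (Suc j)
    thus ?thesis
      using *[of j]
      by (simp add: sum.lessThan_Suc_shift diff_divide_distrib sum_divide_distrib mult_ac del: sum.lessThan_Suc)
  qed
qed

text \<open>
  If the real parts of the coefficients vanish for one parity of the index, then the real part of the
  amplitude has an expansion in every other power, starting at \<open>p\<close>. The bound \<open>O (1 / x ^ (n + 1))\<close>
  for the error after the power \<open>n = 2 * M + p\<close> gives the required \<open>o (1 / x ^ n)\<close>.
\<close>
lemma inverse_power_expansion_Re:
  assumes H: "inverse_power_expansion H c" and p: "p \<le> 1"
    and c: "\<And>k. Re (c k) = (if even (k + p) then a (k div 2) else 0)"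
  shows "has_asymptotic_expansion (\<lambda>x. Re (H x)) a (\<lambda>m x. 1 / x ^ (2 * m + p)) at_top"
  unfolding has_asymptotic_expansion_def
proof (intro conjI allI)
  have small: "(\<lambda>x::real. 1 / x ^ (n + Suc j)) \<in> o[at_top](\<lambda>x. 1 / x ^ n)" for n j
  proof (rule smalloI_tendsto)
    have "((\<lambda>x::real. inverse x ^ Suc j) \<longlongrightarrow> 0) at_top"
      using tendsto_power[OF tendsto_inverse_0_at_top[OF filterlim_ident], of "Suc j"] by simp
    thus "((\<lambda>x::real. (1 / x ^ (n + Suc j)) / (1 / x ^ n)) \<longlongrightarrow> 0) at_top"
      by (rule Lim_transform_eventually)
         (auto simp: power_add field_simps intro!: eventually_mono[OF eventually_gt_at_top[of 0]])
    show "\<forall>\<^sub>F x::real in at_top. 1 / x ^ n \<noteq> 0"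
      by (rule eventually_mono[OF eventually_gt_at_top[of 0]]) auto
  qed
  show "(\<lambda>x::real. 1 / x ^ (2 * Suc m + p)) \<in> o[at_top](\<lambda>x. 1 / x ^ (2 * m + p))" for m
    using small[of "2 * m + p" 1] by (simp add: add_ac)
  fix M
  define n where "n = 2 * M + p"
  have "(\<lambda>x. Re (H x - (\<Sum>k<Suc n. c k / of_real x ^ k))) \<in> O[at_top](\<lambda>x. 1 / x ^ Suc n)"
  proof -
    have "(\<lambda>x. H x - (\<Sum>k<Suc n. c k / of_real x ^ k)) \<in> O[at_top](\<lambda>x. 1 / of_real x ^ Suc n)"
      using H unfolding inverse_power_expansion_def by (rule spec)
    then obtain C where "\<forall>\<^sub>F x in at_top. norm (H x - (\<Sum>k<Suc n. c k / of_real x ^ k)) \<le>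
        C * norm (1 / complex_of_real x ^ Suc n)"
      by (elim landau_o.bigE)
    hence "\<forall>\<^sub>F x in at_top. norm (Re (H x - (\<Sum>k<Suc n. c k / of_real x ^ k))) \<le>
        C * norm (1 / x ^ Suc n)"
    proof eventually_elim
      case (elim x)
      have "norm (1 / complex_of_real x ^ Suc n) = norm (1 / x ^ Suc n)"
        by (simp only: norm_divide norm_power norm_of_real norm_one) simp
      with elim show ?case
        using abs_Re_le_cmod[of "H x - (\<Sum>k<Suc n. c k / of_real x ^ k)"]
        by (simp only: real_norm_def)
    qed
    thus ?thesis by (rule bigoI)
  qed
  also have "(\<lambda>x::real. 1 / x ^ Suc n) \<in> o[at_top](\<lambda>x. 1 / x ^ n)"
    using small[of n 0] by simp
  finally have remainder: "(\<lambda>x. Re (H x - (\<Sum>k<Suc n. c k / of_real x ^ k))) \<in> o[at_top](\<lambda>x. 1 / x ^ n)" .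
  have real_sum: "Re (\<Sum>k<Suc n. c k / of_real x ^ k) = (\<Sum>m\<le>M. a m * (1 / x ^ (2 * m + p)))" for x
  proof -
    have Re: "Re (c k / of_real x ^ k) = Re (c k) / x ^ k" for k
      by (simp flip: of_real_power)
    show ?thesis
      unfolding n_def Re_sum Re
    proof (induction M)
      case 0
      thus ?case using p by (cases p) (auto simp: c)
    next
      case (Suc M)
      have "{..<Suc (2 * Suc M + p)} = insert (2 * M + p + 2) (insert (2 * M + p + 1) {..<Suc (2 * M + p)})"
        by auto
      thus ?case using Suc.IH p by (simp add: c del: sum.lessThan_Suc)
    qed
  qed
  show "(\<lambda>x. Re (H x) - (\<Sum>m\<le>M. a m * (1 / x ^ (2 * m + p)))) \<in> o[at_top](\<lambda>x. 1 / x ^ (2 * M + p))"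
    using remainder unfolding minus_complex.sel real_sum unfolding n_def .
qed

section \<open>Watson's lemma\<close>

lemma has_integral_powr_exp:
  fixes b x :: real
  assumes b: "b > -1" and x: "x > 0"
  shows "((\<lambda>s. s powr b * exp (- x * s)) has_integral Gamma (b + 1) / x powr (b + 1)) {0..}"
proof -
  let ?f = "\<lambda>t::real. t powr b / exp t"
  have f: "(?f has_integral Gamma (b + 1)) {0..}"
    using Gamma_integral_real[of "b + 1"] b by simp
  have im: "(*) x ` {0..} = {0..}"
    using x by (auto simp: image_iff intro!: bexI[of _ "_ / x"])
  have "?f absolutely_integrable_on {0..}"
    using f by (intro nonnegative_absolutely_integrable_1) (auto simp: integrable_on_def)
  hence "?f absolutely_integrable_on (*) x ` {0..} \<and> integral ((*) x ` {0..}) ?f = Gamma (b + 1)"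
    using f im by (simp add: integral_unique)
  hence "(\<lambda>s. \<bar>x\<bar> * ?f (x * s)) absolutely_integrable_on {0..} \<and>
         integral {0..} (\<lambda>s. \<bar>x\<bar> * ?f (x * s)) = Gamma (b + 1)"
    by (subst has_absolute_integral_change_of_variables_1')
       (use x in \<open>auto intro!: derivative_eq_intros inj_onI\<close>)
  hence "((\<lambda>s. \<bar>x\<bar> * ?f (x * s)) has_integral Gamma (b + 1)) {0..}"
    using absolutely_integrable_on_def has_integral_iff by blast
  hence "((\<lambda>s. 1 / x powr (b + 1) * (\<bar>x\<bar> * ?f (x * s))) has_integral (1 / x powr (b + 1) * Gamma (b + 1))) {0..}"
    by (rule has_integral_mult_right)
  thus ?thesis
    by (rule has_integral_eq[rotated, THEN iffD1[OF arg_cong[of _ _ "\<lambda>I. (_ has_integral I) _"], rotated]])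
       (use x in \<open>auto simp: powr_mult powr_add exp_minus field_simps\<close>)
qed

text \<open>
  Termwise Laplace transform: \<open>s powr (a + k)\<close> integrates against \<open>exp (- x * s)\<close> to
  \<open>Gamma (a + 1 + k) / x powr (a + 1 + k)\<close>, and the remainder \<open>C * s ^ M\<close> in the assumption on \<open>g\<close>
  is transformed in the same way. Requiring this bound on the whole half line, and not merely near
  \<open>0\<close>, spares a separate estimate of the tail; it also holds for a \<open>g\<close> that is cut off to \<open>0\<close>
  beyond \<open>s = 1\<close>.
\<close>
lemma Watson_lemma:
  fixes g :: "real \<Rightarrow> complex" and a :: real
  assumes a: "a > -1"
    and int: "\<And>x. x > 0 \<Longrightarrow> (\<lambda>s. of_real (s powr a * exp (- x * s)) * g s) integrable_on {0..}"
    and g: "\<And>M. \<exists>C. \<forall>s\<ge>0. norm (g s - (\<Sum>k<M. b k * of_real s ^ k)) \<le> C * s ^ M"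
  shows "inverse_power_expansion
           (\<lambda>x. of_real (x powr (a + 1)) * integral {0..} (\<lambda>s. of_real (s powr a * exp (- x * s)) * g s))
           (\<lambda>k. b k * of_real (Gamma (a + 1 + real k)))"
  unfolding inverse_power_expansion_def
proof
  fix M
  obtain C where C: "\<And>s. s \<ge> 0 \<Longrightarrow> norm (g s - (\<Sum>k<M. b k * of_real s ^ k)) \<le> C * s ^ M"
    using g[of M] by blast
  let ?E = "\<lambda>x s. s powr a * exp (- x * s)"
  let ?I = "\<lambda>x. integral {0..} (\<lambda>s. of_real (?E x s) * g s)"
  let ?c = "\<lambda>k. b k * of_real (Gamma (a + 1 + real k))"
  have mom: "((\<lambda>s. ?E x s * s ^ k) has_integral Gamma (a + 1 + real k) / x powr (a + 1 + real k)) {0..}"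
    if x: "x > 0" for x :: real and k
  proof -
    have "((\<lambda>s. s powr (a + real k) * exp (- x * s)) has_integral
             Gamma (a + real k + 1) / x powr (a + real k + 1)) {0..}"
      using a x by (intro has_integral_powr_exp) auto
    also have "a + real k + 1 = a + 1 + real k" by simp
    finally show ?thesis
      by (rule has_integral_spike[of "{0}", rotated 2])
         (auto simp: powr_add powr_realpow mult_ac)
  qed
  have bound: "norm (of_real (x powr (a + 1)) * ?I x - (\<Sum>k<M. ?c k / of_real x ^ k)) \<le>
        C * Gamma (a + 1 + real M) * norm (1 / complex_of_real x ^ M)" if x: "x > 0" for x
  proof -
    have momc: "((\<lambda>s. of_real (?E x s) * (b k * of_real s ^ k)) has_integral
        of_real (Gamma (a + 1 + real k) / x powr (a + 1 + real k)) * b k) {0..}" for k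
      using has_integral_mult_left[OF has_integral_of_real[OF mom[OF x, of k]], of "b k"]
      by (simp add: mult_ac)
    have sum: "((\<lambda>s. of_real (?E x s) * (g s - (\<Sum>k<M. b k * of_real s ^ k))) has_integral
        ?I x - (\<Sum>k<M. of_real (Gamma (a + 1 + real k) / x powr (a + 1 + real k)) * b k)) {0..}"
      unfolding right_diff_distrib sum_distrib_left
      by (intro has_integral_diff has_integral_sum momc finite_lessThan integrable_integral int x)
    have scale: "x powr (a + 1) * (y / x powr (a + 1 + real k)) = y / x ^ k" for k y
      using x by (simp add: powr_add powr_realpow)
    have eq: "of_real (x powr (a + 1)) * ?I x - (\<Sum>k<M. ?c k / of_real x ^ k) =
        of_real (x powr (a + 1)) * (?I x -
          (\<Sum>k<M. of_real (Gamma (a + 1 + real k) / x powr (a + 1 + real k)) * b k))"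
    proof -
      have "?c k / of_real x ^ k =
          of_real (x powr (a + 1) * (Gamma (a + 1 + real k) / x powr (a + 1 + real k))) * b k" for k
        unfolding scale by simp
      thus ?thesis by (simp add: right_diff_distrib sum_distrib_left mult_ac)
    qed
    have "norm (?I x - (\<Sum>k<M. of_real (Gamma (a + 1 + real k) / x powr (a + 1 + real k)) * b k)) \<le>
            C * (Gamma (a + 1 + real M) / x powr (a + 1 + real M))"
    proof (rule integral_norm_bound_integral[of "\<lambda>s. of_real (?E x s) * (g s - (\<Sum>k<M. b k * of_real s ^ k))" "{0..}" "\<lambda>s. C * (?E x s * s ^ M)", unfolded integral_unique[OF sum] integral_unique[OF has_integral_mult_right[OF mom[OF x]]]])
      show "(\<lambda>s. of_real (?E x s) * (g s - (\<Sum>k<M. b k * of_real s ^ k))) integrable_on {0..}"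
        using sum by blast
      show "(\<lambda>s. C * (?E x s * s ^ M)) integrable_on {0..}"
        using has_integral_mult_right[OF mom[OF x]] by blast
      show "norm (of_real (?E x s) * (g s - (\<Sum>k<M. b k * of_real s ^ k))) \<le> C * (?E x s * s ^ M)"
        if "s \<in> {0..}" for s
        using mult_left_mono[OF C[of s], of "?E x s"] that by (simp add: norm_mult mult_ac)
    qed
    hence "norm (of_real (x powr (a + 1)) * ?I x - (\<Sum>k<M. ?c k / of_real x ^ k)) \<le>
        x powr (a + 1) * (C * (Gamma (a + 1 + real M) / x powr (a + 1 + real M)))"
      unfolding eq norm_mult by (intro mult_mono) auto
    also have "\<dots> = C * Gamma (a + 1 + real M) * norm (1 / complex_of_real x ^ M)"
      using x scale[of "C * Gamma (a + 1 + real M)" M] by (simp add: norm_divide norm_power)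
    finally show ?thesis .
  qed
  show "(\<lambda>x. of_real (x powr (a + 1)) * ?I x - (\<Sum>k<M. ?c k / of_real x ^ k)) \<in> O[at_top](\<lambda>x. 1 / of_real x ^ M)"
    by (rule bigoI, rule eventually_mono[OF eventually_gt_at_top[of 0]], rule bound)
qed

text \<open>
  Taylor's formula at \<open>0\<close> on the right half of the unit disc, which is convex and where
  \<open>1 \<le> norm (1 + z) \<le> 2\<close>, so that every derivative of \<open>(1 + z) powr a\<close> is bounded there.
\<close>
lemma binomial_Taylor_bound:
  fixes a :: real
  shows "\<exists>C. \<forall>z. Re z \<ge> 0 \<and> norm z \<le> 1 \<longrightarrow>
     norm ((1 + z) powr of_real a - (\<Sum>k<M. of_real (a gchoose k) * z ^ k)) \<le> C * norm z ^ M"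
proof -
  define S where "S = {z::complex. Re z \<ge> 0} \<inter> cball 0 1"
  have S: "convex S"
    unfolding S_def by (intro convex_Int convex_halfspace_Re_ge convex_cball)
  define f where "f = (\<lambda>k (z::complex). of_real (fact k * (a gchoose k)) * (1 + z) powr of_real (a - real k))"
  define B where "B = (\<lambda>k. \<bar>fact k * (a gchoose k)\<bar> * 2 powr \<bar>a - real k\<bar>)"
  have B: "norm (f k z) \<le> B k" if "z \<in> S" for k z
  proof -
    have "1 \<le> Re (1 + z)" using that by (simp add: S_def)
    also have "\<dots> \<le> norm (1 + z)" by (rule complex_Re_le_cmod)
    finally have 1: "1 \<le> norm (1 + z)" .
    have 2: "norm (1 + z) \<le> 2" using that norm_triangle_ineq[of 1 z] by (simp add: S_def)
    have "norm ((1 + z) powr of_real (a - real k)) = norm (1 + z) powr (a - real k)"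
      by (subst norm_powr_real_powr') auto
    also have "\<dots> \<le> norm (1 + z) powr \<bar>a - real k\<bar>"
      using 1 by (intro powr_mono) auto
    also have "\<dots> \<le> 2 powr \<bar>a - real k\<bar>"
      using 2 by (intro powr_mono2) auto
    finally show ?thesis
      unfolding f_def B_def norm_mult by (intro mult_mono) (auto simp: norm_mult abs_mult)
  qed
  have D: "(f k has_field_derivative f (Suc k) z) (at z within S)" if "z \<in> S" for k z
  proof -
    have z: "1 + z \<notin> \<real>\<^sub>\<le>\<^sub>0"
      using that by (auto simp: S_def complex_nonpos_Reals_iff)
    have "fact (Suc k) * (a gchoose Suc k) = fact k * (a gchoose k) * (a - real k)"
      using gbinomial_mult_1[of a k] by (simp add: algebra_simps)
    hence e: "f (Suc k) z = of_real (fact k * (a gchoose k)) *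
        (of_real (a - real k) * (1 + z) powr (of_real (a - real k) - 1))"
      unfolding f_def by (simp only:) (simp add: algebra_simps)
    have "((\<lambda>z. (1 + z) powr of_real (a - real k)) has_field_derivative
        of_real (a - real k) * (1 + z) powr (of_real (a - real k) - 1)) (at z within S)"
      using z by (auto intro!: derivative_eq_intros)
    thus ?thesis
      unfolding e unfolding f_def by (rule DERIV_cmult)
  qed
  have 0: "f k 0 / fact k = of_real (a gchoose k)" for k
    by (simp add: f_def)
  show ?thesis
  proof (cases M)
    case 0
    thus ?thesis using B[of _ 0] by (intro exI[of _ "B 0"]) (auto simp: S_def f_def)
  next
    case (Suc n)
    have e: "f i 0 * (z - 0) ^ i / fact i = of_real (a gchoose i) * z ^ i" for i z
      using 0[of i] by (simp add: field_simps)
    have "norm (f 0 z - (\<Sum>i\<le>n. f i 0 * (z - 0) ^ i / fact i)) \<le> B (Suc n) * norm (z - 0) ^ Suc n / fact n"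
      if z: "z \<in> S" for z
    proof (rule field_Taylor[OF S])
      show "0 \<in> S" by (simp add: S_def)
    qed (rule z D B | assumption)+
    hence *: "norm (f 0 z - (\<Sum>i\<le>n. of_real (a gchoose i) * z ^ i)) \<le> B (Suc n) / fact n * norm z ^ Suc n"
      if "z \<in> S" for z
      using that unfolding e by (simp only: diff_zero times_divide_eq_left)
    show ?thesis
    proof (intro exI[of _ "B (Suc n) / fact n"] allI impI)
      fix z :: complex assume "Re z \<ge> 0 \<and> norm z \<le> 1"
      hence "z \<in> S" by (simp add: S_def)
      thus "norm ((1 + z) powr of_real a - (\<Sum>k<M. of_real (a gchoose k) * z ^ k)) \<le> B (Suc n) / fact n * norm z ^ M"
        using *[of z] by (simp add: f_def Suc lessThan_Suc_atMost del: power_Suc)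
    qed
  qed
qed

section \<open>Contiguous relations for the coefficients\<close>

lemma bessel_A_0: "bessel_A 0 \<nu> = 1"
  by (simp add: bessel_A_def)

lemma bessel_A_Suc:
  "bessel_A (Suc s) \<nu> = bessel_A s \<nu> * (4 * \<nu>\<^sup>2 - (2 * real s + 1)\<^sup>2) / (8 * (real s + 1))"
  by (simp add: bessel_A_def divide_simps) (simp add: algebra_simps)

lemma bessel_A_minus: "bessel_A s (- \<nu>) = bessel_A s \<nu>"
  by (simp add: bessel_A_def)

text \<open>
  With \<open>4 * \<nu>\<^sup>2 - (2 * j - 1)\<^sup>2 = (2 * \<nu> - (2 * j - 1)) * (2 * \<nu> + (2 * j - 1))\<close>, raising \<open>\<nu>\<close> by one moves
  the two runs of factors by one place each, so that \<open>bessel_A (Suc s) (\<nu> + 1)\<close> contains all factors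
  of \<open>bessel_A s \<nu>\<close> and two more.
\<close>
lemma bessel_A_raise:
  "bessel_A (Suc s) (\<nu> + 1) =
     bessel_A s \<nu> * ((2 * \<nu> + 2 * real s + 1) * (2 * \<nu> + 2 * real s + 3)) / (8 * (real s + 1))"
proof (induction s)
  case 0
  thus ?case by (simp add: bessel_A_Suc bessel_A_0 power2_eq_square algebra_simps)
next
  case (Suc s)
  have e1: "4 * (\<nu> + 1)\<^sup>2 - (2 * real (Suc s) + 1)\<^sup>2 = (2 * \<nu> + 2 * real s + 5) * (2 * \<nu> - 2 * real s - 1)"
    by (simp add: power2_eq_square algebra_simps)
  have e2: "4 * \<nu>\<^sup>2 - (2 * real s + 1)\<^sup>2 = (2 * \<nu> + 2 * real s + 1) * (2 * \<nu> - 2 * real s - 1)"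
    by (simp add: power2_eq_square algebra_simps)
  have e3: "2 * \<nu> + 2 * real (Suc s) + 1 = 2 * \<nu> + 2 * real s + 3"
           "2 * \<nu> + 2 * real (Suc s) + 3 = 2 * \<nu> + 2 * real s + 5"
    by simp_all
  show ?case
    unfolding bessel_A_Suc[of "Suc s" "\<nu> + 1"] Suc.IH bessel_A_Suc[of s \<nu>] e1 e2 e3
    by (simp only: times_divide_eq_left times_divide_eq_right mult_ac)
qed

lemma bessel_A_shift_up:
  "bessel_A (Suc s) (\<nu> + 1) = bessel_A (Suc s) \<nu> + (real s + 1 / 2 + \<nu>) * bessel_A s \<nu>"
  unfolding bessel_A_raise bessel_A_Suc[of s \<nu>]
  by (simp add: divide_simps) (simp add: power2_eq_square algebra_simps)

lemma bessel_A_shift_down: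
  "bessel_A (Suc s) (\<nu> - 1) = bessel_A (Suc s) \<nu> + (real s + 1 / 2 - \<nu>) * bessel_A s \<nu>"
  using bessel_A_shift_up[of s "- \<nu>"] bessel_A_minus[of _ \<nu>] bessel_A_minus[of _ "\<nu> - 1"]
  by simp

text \<open>
  The factor \<open>-\<i>\<close> merges the series of \<open>\<tau>\<close> and \<open>\<theta>\<close> into that of one complex amplitude, and it
  makes the four parity cases of the recursion for \<open>bessel_alpha\<close> a single one: the coefficient rule
  for \<open>H \<mapsto> \<i> H + H' - H / (2 x)\<close>, which is the effect on \<open>H\<close> of differentiating
  \<open>cis x * H x / sqrt x\<close>.
\<close>
definition hankel_coeff :: "real \<Rightarrow> nat \<Rightarrow> nat \<Rightarrow> complex" where
  "hankel_coeff \<nu> N k = of_real (bessel_alpha \<nu> k N) * (if even (k + N) then 1 else - \<i>)"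

lemma hankel_coeff_0: "hankel_coeff \<nu> 0 k = \<i> ^ k * of_real (bessel_A k \<nu>)"
proof (cases "even k")
  case True
  thus ?thesis by (auto simp: hankel_coeff_def power_mult elim!: evenE)
next
  case False
  thus ?thesis by (auto simp: hankel_coeff_def power_mult elim!: oddE)
qed

lemma hankel_coeff_Suc_0: "hankel_coeff \<nu> (Suc N) 0 = \<i> * hankel_coeff \<nu> N 0"
  by (auto simp: hankel_coeff_def Let_def complex_eq_iff)

lemma hankel_coeff_Suc_Suc:
  "hankel_coeff \<nu> (Suc N) (Suc k) =
     \<i> * hankel_coeff \<nu> N (Suc k) - (of_nat k + 1 / 2) * hankel_coeff \<nu> N k"
proof (cases "even k")
  case True
  then obtain m where "k = 2 * m" by (elim evenE)
  thus ?thesis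
    by (cases "even N") (simp_all add: hankel_coeff_def Let_def field_simps)
next
  case False
  then obtain m where "k = 2 * m + 1" by (elim oddE)
  thus ?thesis
    by (cases "even N") (simp_all add: hankel_coeff_def Let_def field_simps)
qed

text \<open>
  The counterpart of \<open>2 J\<^sub>\<nu>' = J\<^sub>\<nu>\<^sub>-\<^sub>1 - J\<^sub>\<nu>\<^sub>+\<^sub>1\<close> for coefficients. For \<open>N = 0\<close> it is the mean of the two
  shift relations for \<open>bessel_A\<close>. The step from \<open>N\<close> to \<open>N + 1\<close> is linear with factors that do not
  depend on \<open>\<nu>\<close>, so it preserves the relation.
\<close>
lemma hankel_coeff_contiguous:
  "hankel_coeff \<nu> (Suc N) k = \<i> / 2 * (hankel_coeff (\<nu> - 1) N k + hankel_coeff (\<nu> + 1) N k)"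
proof (induction N arbitrary: k)
  case 0
  show ?case
  proof (cases k)
    case 0
    thus ?thesis by (simp add: hankel_coeff_Suc_0 hankel_coeff_0 bessel_A_0)
  next
    case (Suc j)
    show ?thesis
      unfolding Suc hankel_coeff_Suc_Suc hankel_coeff_0 bessel_A_shift_up bessel_A_shift_down
      by (simp add: algebra_simps)
  qed
next
  case (Suc N)
  have linear: "\<i> * (\<i> / 2 * (A + B)) - t * (\<i> / 2 * (a + b)) =
      \<i> / 2 * ((\<i> * A - t * a) + (\<i> * B - t * b))" for A B a b t :: complex
    by (simp add: field_simps)
  show ?case
  proof (cases k)
    case 0
    thus ?thesis using Suc.IH[of 0] by (simp add: hankel_coeff_Suc_0 algebra_simps)
  next
    case (Suc j)
    show ?thesis
      unfolding Suc hankel_coeff_Suc_Suc[of \<nu> "Suc N" j] Suc.IH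
        hankel_coeff_Suc_Suc[of "\<nu> - 1" N j] hankel_coeff_Suc_Suc[of "\<nu> + 1" N j]
      by (rule linear)
  qed
qed

section \<open>Amplitude and phase\<close>

text \<open>
  The order \<open>\<nu>\<close> enters only through the phase, and \<open>f\<close> is arbitrary. This allows functions that
  belong to different orders to be brought to a common phase and combined linearly.
\<close>
definition has_hankel_form :: "(real \<Rightarrow> real) \<Rightarrow> real \<Rightarrow> (nat \<Rightarrow> complex) \<Rightarrow> bool" where
  "has_hankel_form f \<nu> c \<longleftrightarrow> (\<exists>H. inverse_power_expansion H c \<and>
     (\<forall>\<^sub>F x in at_top. sqrt (1 / 2 * pi * x) * f x = Re (cis (x - \<nu> * pi / 2 - pi / 4) * H x)))"

lemma has_hankel_form_cong:
  assumes "has_hankel_form f \<nu> c" "\<And>x. x > 0 \<Longrightarrow> g x = f x" "\<And>k. d k = c k"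
  shows "has_hankel_form g \<nu> d"
proof -
  have "d = c" using assms(3) by auto
  thus ?thesis
    using assms(1) unfolding has_hankel_form_def
    by (auto elim!: eventually_elim2[OF eventually_gt_at_top[of 0]] simp: assms(2))
qed

lemma has_hankel_form_add:
  assumes "has_hankel_form f \<nu> c" "has_hankel_form g \<nu> d"
  shows "has_hankel_form (\<lambda>x. f x + g x) \<nu> (\<lambda>k. c k + d k)"
proof -
  let ?\<phi> = "\<lambda>x. x - \<nu> * pi / 2 - pi / 4"
  from assms obtain H G where H: "inverse_power_expansion H c" "inverse_power_expansion G d"
    "\<forall>\<^sub>F x in at_top. sqrt (1 / 2 * pi * x) * f x = Re (cis (?\<phi> x) * H x)"
    "\<forall>\<^sub>F x in at_top. sqrt (1 / 2 * pi * x) * g x = Re (cis (?\<phi> x) * G x)"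
    unfolding has_hankel_form_def by blast
  have "\<forall>\<^sub>F x in at_top. sqrt (1 / 2 * pi * x) * (f x + g x) = Re (cis (?\<phi> x) * (H x + G x))"
    using H(3,4) by eventually_elim (simp only: distrib_left plus_complex.sel)
  thus ?thesis
    unfolding has_hankel_form_def using inverse_power_expansion_add[OF H(1,2)] by blast
qed

lemma Re_of_real_mult: "Re (of_real r * z) = r * Re z"
  by simp

lemma has_hankel_form_cmult:
  assumes "has_hankel_form f \<nu> c"
  shows "has_hankel_form (\<lambda>x. r * f x) \<nu> (\<lambda>k. of_real r * c k)"
proof -
  let ?\<phi> = "\<lambda>x. x - \<nu> * pi / 2 - pi / 4"
  from assms obtain H where H: "inverse_power_expansion H c"
    "\<forall>\<^sub>F x in at_top. sqrt (1 / 2 * pi * x) * f x = Re (cis (?\<phi> x) * H x)"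
    unfolding has_hankel_form_def by blast
  have "\<forall>\<^sub>F x in at_top. sqrt (1 / 2 * pi * x) * (r * f x) = Re (cis (?\<phi> x) * (of_real r * H x))"
    using H(2)
  proof eventually_elim
    case (elim x)
    have "sqrt (1 / 2 * pi * x) * (r * f x) = r * Re (cis (?\<phi> x) * H x)"
      unfolding elim [symmetric] by (simp only: mult_ac)
    also have "\<dots> = Re (of_real r * (cis (?\<phi> x) * H x))"
      by (rule Re_of_real_mult [symmetric])
    finally show ?case by (simp only: mult_ac)
  qed
  thus ?thesis
    unfolding has_hankel_form_def using inverse_power_expansion_cmult[OF H(1)] by blast
qed

lemma has_hankel_form_divide_x:
  assumes "has_hankel_form f \<nu> c"
  shows "has_hankel_form (\<lambda>x. f x / x) \<nu> (case_nat 0 c)"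
proof -
  let ?\<phi> = "\<lambda>x. x - \<nu> * pi / 2 - pi / 4"
  from assms obtain H where H: "inverse_power_expansion H c"
    "\<forall>\<^sub>F x in at_top. sqrt (1 / 2 * pi * x) * f x = Re (cis (?\<phi> x) * H x)"
    unfolding has_hankel_form_def by blast
  have "\<forall>\<^sub>F x in at_top. sqrt (1 / 2 * pi * x) * (f x / x) = Re (cis (?\<phi> x) * (H x / of_real x))"
    using H(2) by eventually_elim (simp only: times_divide_eq_right Re_divide_of_real)
  thus ?thesis
    unfolding has_hankel_form_def using inverse_power_expansion_divide_x[OF H(1)] by blast
qed

lemma has_hankel_form_shift_phase:
  assumes "has_hankel_form f \<mu> c" "cis ((\<nu> - \<mu>) * pi / 2) = u"
  shows "has_hankel_form f \<nu> (\<lambda>k. u * c k)"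
proof -
  from assms obtain H where H: "inverse_power_expansion H c"
    "\<forall>\<^sub>F x in at_top. sqrt (1 / 2 * pi * x) * f x = Re (cis (x - \<mu> * pi / 2 - pi / 4) * H x)"
    unfolding has_hankel_form_def by blast
  have "cis (x - \<mu> * pi / 2 - pi / 4) = cis (x - \<nu> * pi / 2 - pi / 4) * u" for x
    unfolding assms(2) [symmetric] cis_mult by (rule arg_cong[of _ _ cis]) (simp add: field_simps)
  hence "\<forall>\<^sub>F x in at_top. sqrt (1 / 2 * pi * x) * f x = Re (cis (x - \<nu> * pi / 2 - pi / 4) * (u * H x))"
    using H(2) by (simp add: mult_ac)
  thus ?thesis
    unfolding has_hankel_form_def using inverse_power_expansion_cmult[OF H(1)] by blast
qed

lemma has_hankel_form_raise:
  assumes "has_hankel_form f (\<nu> - 1) c"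
  shows "has_hankel_form f \<nu> (\<lambda>k. \<i> * c k)"
  by (rule has_hankel_form_shift_phase[OF assms]) (simp add: cis_pi_half)

lemma has_hankel_form_lower:
  assumes "has_hankel_form f (\<nu> + 1) c"
  shows "has_hankel_form f \<nu> (\<lambda>k. - \<i> * c k)"
  by (rule has_hankel_form_shift_phase[OF assms]) (simp add: cis_minus_pi_half)

section \<open>The amplitude of the Bessel function\<close>

text \<open>
  These are the coefficients that \<open>Watson_lemma\<close> yields for \<open>(1 + \<i> s / 2) powr (\<nu> - 1 / 2)\<close>. The
  factorization \<open>4 * \<nu>\<^sup>2 - (2 * k + 1)\<^sup>2 = 4 * (\<nu> - 1 / 2 - k) * (\<nu> + 1 / 2 + k)\<close> separates the product
  \<open>bessel_A\<close> into the binomial coefficient and the quotient of Gamma values.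
\<close>
lemma hankel_coeff_0_eq_Gamma:
  fixes \<nu> :: real
  assumes "\<nu> > 1 / 2"
  shows "hankel_coeff \<nu> 0 k =
           of_real (1 / Gamma (\<nu> + 1 / 2)) *
           (of_real ((\<nu> - 1 / 2) gchoose k) * (\<i> / 2) ^ k * of_real (Gamma (\<nu> + 1 / 2 + real k)))"
proof -
  have pos: "Gamma (\<nu> + 1 / 2) > 0" using assms by (intro Gamma_real_pos) auto
  have "bessel_A k \<nu> * Gamma (\<nu> + 1 / 2) = ((\<nu> - 1 / 2) gchoose k) / 2 ^ k * Gamma (\<nu> + 1 / 2 + real k)"
  proof (induction k)
    case 0
    thus ?case by (simp add: bessel_A_0)
  next
    case (Suc k)
    have "Gamma (\<nu> + 1 / 2 + real (Suc k)) = (\<nu> + 1 / 2 + real k) * Gamma (\<nu> + 1 / 2 + real k)"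
      using assms Gamma_plus1[of "\<nu> + 1 / 2 + real k"] nonpos_Ints_nonpos[of "\<nu> + 1 / 2 + real k"]
      by (auto simp: add_ac)
    moreover have "((\<nu> - 1 / 2) gchoose Suc k) = ((\<nu> - 1 / 2) gchoose k) * (\<nu> - 1 / 2 - real k) / (real k + 1)"
      using gbinomial_mult_1[of "\<nu> - 1 / 2" k] by (simp add: field_simps)
    moreover have "bessel_A (Suc k) \<nu> * Gamma (\<nu> + 1 / 2) =
        bessel_A k \<nu> * Gamma (\<nu> + 1 / 2) * ((\<nu> - 1 / 2 - real k) * (\<nu> + 1 / 2 + real k)) / (2 * (real k + 1))"
      unfolding bessel_A_Suc by (simp add: divide_simps) (simp add: power2_eq_square algebra_simps)
    ultimately show ?case unfolding Suc.IH by (simp add: mult_ac)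
  qed
  hence "bessel_A k \<nu> = 1 / Gamma (\<nu> + 1 / 2) * (((\<nu> - 1 / 2) gchoose k) / 2 ^ k * Gamma (\<nu> + 1 / 2 + real k))"
    using pos by (simp add: field_simps)
  thus ?thesis
    unfolding hankel_coeff_0 by (simp add: power_divide)
qed

text \<open>
  Poisson's integral, the contour shift and Watson's lemma combined. The factor \<open>K x\<close> is what the
  normalization \<open>sqrt (pi * x / 2)\<close>, the power \<open>(x / 2) powr \<nu>\<close> and the constant in Poisson's
  integral amount to.
\<close>
lemma has_hankel_form_bessel_J_Poisson:
  assumes \<nu>: "\<nu> > 1 / 2"
  shows "has_hankel_form (bessel_J \<nu>) \<nu> (hankel_coeff \<nu> 0)"
proof -
  define a where "a = \<nu> - 1 / 2"
  have a: "a > 0" and \<nu>_eq: "\<nu> = a + 1 / 2" using \<nu> by (simp_all add: a_def)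
  \<comment> \<open>Cutting off at \<open>1\<close> turns the integral over the edge into one over the half line.\<close>
  define g where "g = (\<lambda>s::real. if s \<in> {0..1} then (1 + \<i> * of_real s / 2) powr of_real a else 0)"
  define b where "b = (\<lambda>k. of_real (a gchoose k) * (\<i> / 2) ^ k)"
  define P where "P = (\<lambda>x. integral {0..1} (\<lambda>t. (1 - t\<^sup>2) powr a * cos (x * t)))"
  define L where "L = (\<lambda>x. integral {0..} (\<lambda>s. of_real (s powr a * exp (- x * s)) * g s))"
  define K where "K = (\<lambda>x. x powr (a + 1) * 2 powr (- a) / Gamma (a + 1))"
  have \<Gamma>: "Gamma (a + 1) > 0" using a by (intro Gamma_real_pos) auto

  have cont: "continuous_on {0..1} (\<lambda>s. of_real (s powr a * exp (- x * s)) * (1 + \<i> * of_real s / 2) powr of_real a)"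
    for x :: real
    using a by (intro continuous_intros continuous_on_powr_complex continuous_on_powr') (auto simp: complex_eq_iff)
  have int: "((\<lambda>s. of_real (s powr a * exp (- x * s)) * g s) has_integral
       integral {0..1} (\<lambda>s. of_real (s powr a * exp (- x * s)) * (1 + \<i> * of_real s / 2) powr of_real a)) {0..}"
    for x :: real
  proof (rule has_integral_on_superset)
    show "((\<lambda>s. of_real (s powr a * exp (- x * s)) * g s) has_integral
       integral {0..1} (\<lambda>s. of_real (s powr a * exp (- x * s)) * (1 + \<i> * of_real s / 2) powr of_real a)) {0..1}"
      by (rule has_integral_eq[OF _ integrable_integral[OF integrable_continuous_real[OF cont]]])
         (simp add: g_def)
  qed (auto simp: g_def)

  have g_bound: "\<exists>C. \<forall>s\<ge>0. norm (g s - (\<Sum>k<M. b k * of_real s ^ k)) \<le> C * s ^ M" for M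
  proof -
    obtain C where C: "\<And>z. Re z \<ge> 0 \<Longrightarrow> norm z \<le> 1 \<Longrightarrow>
        norm ((1 + z) powr of_real a - (\<Sum>k<M. of_real (a gchoose k) * z ^ k)) \<le> C * norm z ^ M"
      using binomial_Taylor_bound[of a M] by blast
    define D where "D = (\<Sum>k<M. norm (b k))"
    have "norm (g s - (\<Sum>k<M. b k * of_real s ^ k)) \<le> max (C / 2 ^ M) D * s ^ M" if s: "s \<ge> 0" for s
    proof (cases "s \<le> 1")
      case True
      have "norm (g s - (\<Sum>k<M. b k * of_real s ^ k)) \<le> C * norm (\<i> * of_real s / 2) ^ M"
        using C[of "\<i> * of_real s / 2"] s True
        by (simp add: g_def b_def norm_mult power_mult_distrib power_divide mult_ac)
      also have "\<dots> = C / 2 ^ M * s ^ M"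
        using s by (simp add: norm_mult norm_divide power_divide)
      also have "\<dots> \<le> max (C / 2 ^ M) D * s ^ M"
        using s by (intro mult_right_mono) auto
      finally show ?thesis .
    next
      case False
      have "norm (\<Sum>k<M. b k * of_real s ^ k) \<le> (\<Sum>k<M. norm (b k) * s ^ M)"
        using False by (intro sum_norm_le) (auto simp: norm_mult norm_power intro!: mult_left_mono power_increasing)
      also have "\<dots> = D * s ^ M" by (simp add: D_def sum_distrib_right)
      also have "\<dots> \<le> max (C / 2 ^ M) D * s ^ M"
        using s by (intro mult_right_mono) auto
      finally show ?thesis using False by (simp add: g_def)
    qed
    thus ?thesis by blast
  qed

  have W: "inverse_power_expansion (\<lambda>x. of_real (x powr (a + 1)) * L x)
             (\<lambda>k. b k * of_real (Gamma (a + 1 + real k)))"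
    unfolding L_def using a int g_bound by (intro Watson_lemma) auto

  have "\<forall>x. \<exists>r. \<bar>r\<bar> \<le> 3 powr a * exp (- x) \<and>
          P x = r + Re (cis (x - \<nu> * pi / 2 - pi / 4) * (of_real (2 powr a) * L x))"
  proof
    fix x :: real
    obtain r where r: "\<bar>r\<bar> \<le> 3 powr a * exp (- x)"
      "P x = r + Re (- \<i> * cis (x - a * pi / 2) * integral {0..1} (\<lambda>s.
            of_real ((2 * s) powr a * exp (- x * s)) * (1 + \<i> * of_real s / 2) powr of_real a))"
      unfolding P_def using Poisson_contour_shift[OF a, of x] by blast
    have "- \<i> * cis (x - a * pi / 2) = cis (x - \<nu> * pi / 2 - pi / 4)"
    proof -
      have "- \<i> * cis (x - a * pi / 2) = cis (- (pi / 2)) * cis (x - a * pi / 2)" by simp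
      also have "\<dots> = cis (x - \<nu> * pi / 2 - pi / 4)"
        unfolding cis_mult \<nu>_eq by (rule arg_cong[of _ _ cis]) (simp add: field_simps)
      finally show ?thesis .
    qed
    moreover have "integral {0..1} (\<lambda>s.
            of_real ((2 * s) powr a * exp (- x * s)) * (1 + \<i> * of_real s / 2) powr of_real a) =
          of_real (2 powr a) * L x"
    proof -
      have "integral {0..1} (\<lambda>s.
            of_real ((2 * s) powr a * exp (- x * s)) * (1 + \<i> * of_real s / 2) powr of_real a) =
          integral {0..1} (\<lambda>s. of_real (2 powr a) *
            (of_real (s powr a * exp (- x * s)) * (1 + \<i> * of_real s / 2) powr of_real a))"
        by (intro integral_cong) (simp add: powr_mult mult_ac)
      also have "\<dots> = of_real (2 powr a) * L x"
        unfolding L_def integral_unique[OF int] by (rule integral_mult_right)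
      finally show ?thesis .
    qed
    ultimately show "\<exists>r. \<bar>r\<bar> \<le> 3 powr a * exp (- x) \<and>
          P x = r + Re (cis (x - \<nu> * pi / 2 - pi / 4) * (of_real (2 powr a) * L x))"
      using r by auto
  qed
  then obtain r where r: "\<And>x. \<bar>r x\<bar> \<le> 3 powr a * exp (- x)"
    and P: "\<And>x. P x = r x + Re (cis (x - \<nu> * pi / 2 - pi / 4) * (of_real (2 powr a) * L x))"
    by metis

  have J: "sqrt (1 / 2 * pi * x) * bessel_J \<nu> x = K x * P x" if x: "x > 0" for x
  proof -
    have Poisson: "P x = sqrt pi * Gamma (a + 1) / 2 * bessel_entire \<nu> (x\<^sup>2 / 4)"
      unfolding P_def \<nu>_eq by (rule integral_unique[OF has_integral_Poisson[OF a]])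
    have factor: "sqrt (1 / 2 * pi * x) * (x / 2) powr \<nu> = K x * (sqrt pi * Gamma (a + 1) / 2)"
    proof -
      have "sqrt (1 / 2 * pi * x) = sqrt pi * (x / 2) powr (1 / 2)"
        using x by (simp add: real_sqrt_mult powr_half_sqrt real_sqrt_divide)
      moreover have "(x / 2) powr (1 / 2) * (x / 2) powr \<nu> = (x / 2) powr (a + 1)"
        by (simp add: \<nu>_eq add.commute flip: powr_add)
      moreover have "(x / 2) powr (a + 1) = x powr (a + 1) * 2 powr (- a) / 2"
        using x by (simp add: powr_divide powr_add powr_minus field_simps)
      ultimately show ?thesis using \<Gamma> by (simp add: K_def mult.assoc)
    qed
    have "sqrt (1 / 2 * pi * x) * bessel_J \<nu> x =
        (sqrt (1 / 2 * pi * x) * (x / 2) powr \<nu>) * bessel_entire \<nu> (x\<^sup>2 / 4)"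
      by (simp only: bessel_J_eq mult.assoc)
    also have "\<dots> = K x * P x"
      unfolding factor Poisson by (simp only: mult.assoc)
    finally show ?thesis .
  qed

  \<comment> \<open>The exponentially small error is absorbed into the amplitude: as it is real, multiplying it by the conjugate of the phase factor makes it the real part of phase times amplitude.\<close>
  define E where "E = (\<lambda>x. cis (- (x - \<nu> * pi / 2 - pi / 4)) * of_real (K x * r x))"
  have E: "inverse_power_expansion E (\<lambda>_. 0)"
    unfolding inverse_power_expansion_def
  proof
    fix M
    have "\<forall>\<^sub>F x::real in at_top. x powr (a + 1 + real M) * exp (- x) \<le> 1"
    proof -
      have "((\<lambda>x::real. x powr (a + 1 + real M) * exp (- x)) \<longlongrightarrow> 0) at_top"
        by real_asymp
      thus ?thesis
        by (rule eventually_mono[OF order_tendstoD(2)[of _ 0 _ 1]]) auto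
    qed
    with eventually_gt_at_top[of 0]
    have "\<forall>\<^sub>F x in at_top. norm (E x) \<le> 2 powr (- a) / Gamma (a + 1) * 3 powr a * norm (1 / complex_of_real x ^ M)"
    proof eventually_elim
      case (elim x)
      have "K x \<ge> 0"
        using \<Gamma> by (simp add: K_def)
      hence "norm (E x) = K x * \<bar>r x\<bar>"
        unfolding E_def norm_mult norm_cis norm_of_real by (simp add: abs_mult)
      also have "\<dots> \<le> K x * (3 powr a * exp (- x))"
        using r \<Gamma> by (intro mult_left_mono) (auto simp: K_def)
      also have "\<dots> = 2 powr (- a) / Gamma (a + 1) * 3 powr a * (x powr (a + 1 + real M) * exp (- x)) / x ^ M"
        using elim by (simp add: K_def powr_add powr_realpow)
      also have "\<dots> \<le> 2 powr (- a) / Gamma (a + 1) * 3 powr a * 1 / x ^ M"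
        using elim \<Gamma> by (intro divide_right_mono mult_left_mono) auto
      finally show ?case using elim by (simp add: norm_divide norm_power)
    qed
    hence "E \<in> O[at_top](\<lambda>x. 1 / of_real x ^ M)"
      by (rule bigoI)
    thus "(\<lambda>x. E x - (\<Sum>k<M. 0 / of_real x ^ k)) \<in> O[at_top](\<lambda>x. 1 / of_real x ^ M)"
      by simp
  qed

  define H where "H = (\<lambda>x. of_real (1 / Gamma (a + 1)) * (of_real (x powr (a + 1)) * L x) + E x)"
  have "inverse_power_expansion H
          (\<lambda>k. of_real (1 / Gamma (a + 1)) * (b k * of_real (Gamma (a + 1 + real k))) + 0)"
    unfolding H_def by (intro inverse_power_expansion_add inverse_power_expansion_cmult W E)
  also have "(\<lambda>k. of_real (1 / Gamma (a + 1)) * (b k * of_real (Gamma (a + 1 + real k))) + 0) = hankel_coeff \<nu> 0"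
    using \<nu> by (intro ext) (simp add: hankel_coeff_0_eq_Gamma b_def a_def add_ac mult_ac)
  finally have H: "inverse_power_expansion H (hankel_coeff \<nu> 0)" .
  have "sqrt (1 / 2 * pi * x) * bessel_J \<nu> x = Re (cis (x - \<nu> * pi / 2 - pi / 4) * H x)" if x: "x > 0" for x
  proof -
    define u where "u = cis (x - \<nu> * pi / 2 - pi / 4)"
    have error: "u * E x = of_real (K x * r x)"
      unfolding E_def u_def mult.assoc [symmetric] cis_mult by simp
    have main: "u * (of_real (1 / Gamma (a + 1)) * (of_real (x powr (a + 1)) * L x)) =
                   of_real (K x) * (u * (of_real (2 powr a) * L x))"
      by (simp add: K_def powr_minus field_simps)
    have "Re (u * H x) = K x * P x"
      unfolding H_def P distrib_left u_def [symmetric] error main plus_complex.sel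
        Re_of_real_mult Re_complex_of_real by (rule add.commute)
    thus ?thesis using J[OF x] by (simp add: u_def)
  qed
  with H show ?thesis
    unfolding has_hankel_form_def by (blast intro: eventually_mono[OF eventually_gt_at_top[of 0]])
qed

text \<open>
  Every real order is reached from \<open>\<nu> > 1 / 2\<close> by downward steps of the three-term recurrence. The
  coefficients follow, because the difference of the two shift relations for \<open>bessel_A\<close> is
  \<open>bessel_A (Suc s) (\<nu> + 1) - bessel_A (Suc s) (\<nu> - 1) = 2 * \<nu> * bessel_A s \<nu>\<close>.
\<close>
lemma has_hankel_form_bessel_J:
  "has_hankel_form (bessel_J \<nu>) \<nu> (hankel_coeff \<nu> 0)"
proof -
  have "has_hankel_form (bessel_J \<nu>) \<nu> (hankel_coeff \<nu> 0)" if "\<nu> > 1 / 2 - real n" for n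
    using that
  proof (induction n arbitrary: \<nu>)
    case 0
    thus ?case by (simp add: has_hankel_form_bessel_J_Poisson)
  next
    case (Suc n)
    define \<mu> where "\<mu> = \<nu> + 1"
    have \<nu>: "\<nu> = \<mu> - 1" by (simp add: \<mu>_def)
    have 1: "has_hankel_form (bessel_J \<mu>) \<mu> (hankel_coeff \<mu> 0)"
      and 2: "has_hankel_form (bessel_J (\<mu> + 1)) (\<mu> + 1) (hankel_coeff (\<mu> + 1) 0)"
      using Suc.prems by (auto intro!: Suc.IH simp: \<mu>_def)
    have "has_hankel_form (\<lambda>x. 2 * \<mu> * (bessel_J \<mu> x / x) + (-1) * bessel_J (\<mu> + 1) x) \<mu>
            (\<lambda>k. of_real (2 * \<mu>) * case_nat 0 (hankel_coeff \<mu> 0) k +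
                 of_real (-1) * (- \<i> * hankel_coeff (\<mu> + 1) 0 k))"
      by (intro has_hankel_form_add has_hankel_form_cmult has_hankel_form_divide_x
                has_hankel_form_lower 1 2)
    hence "has_hankel_form (\<lambda>x. 2 * \<mu> * (bessel_J \<mu> x / x) + (-1) * bessel_J (\<mu> + 1) x) \<nu>
            (\<lambda>k. - \<i> * (of_real (2 * \<mu>) * case_nat 0 (hankel_coeff \<mu> 0) k +
                 of_real (-1) * (- \<i> * hankel_coeff (\<mu> + 1) 0 k)))"
      by (intro has_hankel_form_lower) (simp add: \<mu>_def)
    thus ?case
    proof (rule has_hankel_form_cong)
      show "bessel_J \<nu> x = 2 * \<mu> * (bessel_J \<mu> x / x) + (-1) * bessel_J (\<mu> + 1) x" if "x > 0" for x
        unfolding \<nu> bessel_J_recurrence[OF that] by simp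
      show "hankel_coeff \<nu> 0 k = - \<i> * (of_real (2 * \<mu>) * case_nat 0 (hankel_coeff \<mu> 0) k +
                 of_real (-1) * (- \<i> * hankel_coeff (\<mu> + 1) 0 k))" for k
      proof (cases k)
        case 0
        thus ?thesis by (simp add: hankel_coeff_0 bessel_A_0)
      next
        case (Suc j)
        show ?thesis
          unfolding \<nu> Suc nat.case hankel_coeff_0 bessel_A_shift_up bessel_A_shift_down
          by (simp add: algebra_simps)
      qed
    qed
  qed
  moreover have "\<nu> > 1 / 2 - real (nat \<lceil>1 - \<nu>\<rceil>)" by linarith
  ultimately show ?thesis by blast
qed

section \<open>Derivatives of all orders\<close>

lemma has_hankel_form_higher_deriv_bessel_J:
  "has_hankel_form ((deriv ^^ N) (bessel_J \<nu>)) \<nu> (hankel_coeff \<nu> N)"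
proof (induction N arbitrary: \<nu>)
  case 0
  thus ?case by (simp add: has_hankel_form_bessel_J)
next
  case (Suc N)
  have "has_hankel_form (\<lambda>x. (1 / 2) * ((deriv ^^ N) (bessel_J (\<nu> - 1)) x + (- 1) * (deriv ^^ N) (bessel_J (\<nu> + 1)) x)) \<nu>
          (\<lambda>k. of_real (1 / 2) * (\<i> * hankel_coeff (\<nu> - 1) N k + of_real (- 1) * (- \<i> * hankel_coeff (\<nu> + 1) N k)))"
    by (intro has_hankel_form_add has_hankel_form_cmult has_hankel_form_raise has_hankel_form_lower Suc.IH)
  thus ?case
    by (rule has_hankel_form_cong)
       (auto simp: higher_deriv_bessel_J_Suc hankel_coeff_contiguous field_simps simp del: funpow.simps)
qed

theorem theorem2p1:
  fixes \<nu> :: real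
  shows "\<exists>\<tau> \<theta> :: nat \<Rightarrow> real \<Rightarrow> real. \<forall>n.
    (\<forall>\<^sub>F x in at_top.
       sqrt (1 / 2 * pi * x) * (deriv ^^ (2 * n)) (bessel_J \<nu>) x =
         cos (x - \<nu> * pi / 2 - pi / 4) * \<tau> (2 * n) x +
         sin (x - \<nu> * pi / 2 - pi / 4) * \<theta> (2 * n) x) \<and>
    (\<forall>\<^sub>F x in at_top.
       sqrt (1 / 2 * pi * x) * (deriv ^^ (2 * n + 1)) (bessel_J \<nu>) x =
         cos (x - \<nu> * pi / 2 - pi / 4) * \<theta> (2 * n + 1) x +
         sin (x - \<nu> * pi / 2 - pi / 4) * \<tau> (2 * n + 1) x) \<and>
    (\<forall>N \<in> {2 * n, 2 * n + 1}.
       has_asymptotic_expansion (\<tau> N)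
         (\<lambda>m. bessel_alpha \<nu> (2 * m) N) (\<lambda>m x. 1 / x ^ (2 * m)) at_top \<and>
       has_asymptotic_expansion (\<theta> N)
         (\<lambda>m. bessel_alpha \<nu> (2 * m + 1) N) (\<lambda>m x. 1 / x ^ (2 * m + 1)) at_top)"
proof -
  define \<phi> where "\<phi> = (\<lambda>x. x - \<nu> * pi / 2 - pi / 4)"
  have "\<forall>N. \<exists>H. inverse_power_expansion H (hankel_coeff \<nu> N) \<and>
          (\<forall>\<^sub>F x in at_top. sqrt (1 / 2 * pi * x) * (deriv ^^ N) (bessel_J \<nu>) x = Re (cis (\<phi> x) * H x))"
    using has_hankel_form_higher_deriv_bessel_J unfolding has_hankel_form_def \<phi>_def by (rule allI)
  from choice[OF this] obtain H where
    HJ: "\<forall>N. inverse_power_expansion (H N) (hankel_coeff \<nu> N) \<and>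
          (\<forall>\<^sub>F x in at_top. sqrt (1 / 2 * pi * x) * (deriv ^^ N) (bessel_J \<nu>) x = Re (cis (\<phi> x) * H N x))" ..
  have H: "inverse_power_expansion (H N) (hankel_coeff \<nu> N)" for N
    by (rule conjunct1 [OF spec [OF HJ, of N]])
  have J: "\<forall>\<^sub>F x in at_top. sqrt (1 / 2 * pi * x) * (deriv ^^ N) (bessel_J \<nu>) x = Re (cis (\<phi> x) * H N x)" for N
    by (rule conjunct2 [OF spec [OF HJ, of N]])
  \<comment> \<open>\<open>Re (cis \<phi> * H) = cos \<phi> * Re H - sin \<phi> * Im H\<close>, and \<open>- Im H = Re (\<i> * H)\<close>; the roles of the two parts are exchanged for odd \<open>N\<close>.\<close>
  define \<tau> where "\<tau> = (\<lambda>N x. Re ((if even N then 1 else \<i>) * H N x))"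
  define \<theta> where "\<theta> = (\<lambda>N x. Re ((if even N then \<i> else 1) * H N x))"
  have \<tau>: "has_asymptotic_expansion (\<tau> N) (\<lambda>m. bessel_alpha \<nu> (2 * m) N) (\<lambda>m x. 1 / x ^ (2 * m + 0)) at_top" for N
    unfolding \<tau>_def
    by (intro inverse_power_expansion_Re[OF inverse_power_expansion_cmult[OF H]])
       (auto simp: hankel_coeff_def)
  have \<theta>: "has_asymptotic_expansion (\<theta> N) (\<lambda>m. bessel_alpha \<nu> (2 * m + 1) N) (\<lambda>m x. 1 / x ^ (2 * m + 1)) at_top" for N
    unfolding \<theta>_def
    by (intro inverse_power_expansion_Re[OF inverse_power_expansion_cmult[OF H]])
       (auto simp: hankel_coeff_def elim!: oddE)
  show ?thesis
  proof (rule exI[of _ \<tau>], rule exI[of _ \<theta>], intro allI conjI ballI)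
    fix n
    show "\<forall>\<^sub>F x in at_top. sqrt (1 / 2 * pi * x) * (deriv ^^ (2 * n)) (bessel_J \<nu>) x =
         cos (x - \<nu> * pi / 2 - pi / 4) * \<tau> (2 * n) x + sin (x - \<nu> * pi / 2 - pi / 4) * \<theta> (2 * n) x"
      using J[of "2 * n"] by eventually_elim (simp add: \<tau>_def \<theta>_def \<phi>_def)
    show "\<forall>\<^sub>F x in at_top. sqrt (1 / 2 * pi * x) * (deriv ^^ (2 * n + 1)) (bessel_J \<nu>) x =
         cos (x - \<nu> * pi / 2 - pi / 4) * \<theta> (2 * n + 1) x + sin (x - \<nu> * pi / 2 - pi / 4) * \<tau> (2 * n + 1) x"
      using J[of "2 * n + 1"] by eventually_elim (simp add: \<tau>_def \<theta>_def \<phi>_def del: funpow.simps)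
  next
    fix N
    show "has_asymptotic_expansion (\<tau> N) (\<lambda>m. bessel_alpha \<nu> (2 * m) N) (\<lambda>m x. 1 / x ^ (2 * m)) at_top"
      using \<tau>[of N] by simp
    show "has_asymptotic_expansion (\<theta> N) (\<lambda>m. bessel_alpha \<nu> (2 * m + 1) N) (\<lambda>m x. 1 / x ^ (2 * m + 1)) at_top"
      by (rule \<theta>)
  qed
qed

end
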